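(* Any language $L$ that is linear-space reducible to $L_{KG}$ is verified by a 2ADfA with bounded error $\epsilon$, moreover, the protocol achieves perfect completeness.
   Context: The Knapsack-game language is $L_{KG}=\{ S\, \forall(a_1,b_1)\, \exists(e_1,f_1)\, \cdots \, \forall(a_n,b_n)\, \exists(e_n,f_n) \}$, where $S$ and each $a_i,b_i,e_i,f_i$ are natural numbers given in binary, and for every $x\in \prod_{i=1}^{n}\{a_i,b_i\}$ there exists $y\in \prod_{i=1}^{n}\{e_i,f_i\}$ with $S=\sum_{i=1}^{n}(x_i+y_i)$. An affine state of an $m$-state affine register is a vector $v\in\mathbb{R}^m$ whose entries sum to $1$; affine operators are real matrices whose columns each sum to $1$; weighting observes basis state $e_j$ with probability $|v_j|/\|v\|_1$. A 2ADfA is a two-way deterministic finite automaton on the read-only input $¢ w\$$ (left end-marker ¢, right end-marker \$) equipped with finitely many affine registers (with rational transition matrices), each updated by an affine operator or weighted at each step, with the deterministic state and head move then depending on state, symbol and weighting outcomes; it halts upon entering an accepting or rejecting state. The 2ADfA is the verifier in an Arthur–Merlin proof system (public coins: deterministic states, head moves and weighting outcomes are revealed to the all-powerful prover). Verification with error $\epsilon<1/2$ (rational): some prover makes every $w\in L$ accepted with probability at least $1-\epsilon$, and for every $w\notin L$ and every prover, $w$ is rejected with probability at least $1-\epsilon$. Perfect completeness means every $w\in L$ is accepted with probability $1$. *)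

theory Defs
  imports Complex_Main
begin

datatype 'a tsym = LEnd | REnd | Sym 'a

definition tape :: "'a list \<Rightarrow> nat \<Rightarrow> 'a tsym" where
  "tape w h = (if h = 0 then LEnd else if h \<le> length w then Sym (w ! (h - 1)) else REnd)"

datatype kg_sym = K0 | K1 | KAll | KEx | KLP | KRP | KComma

definition is_bin :: "kg_sym list \<Rightarrow> bool" where
  "is_bin s \<longleftrightarrow> s = [K0] \<or> (s \<noteq> [] \<and> hd s = K1 \<and> set s \<subseteq> {K0, K1})"

definition bin_val :: "kg_sym list \<Rightarrow> nat" where
  "bin_val s = foldl (\<lambda>acc d. 2 * acc + (if d = K1 then 1 else 0)) 0 s"

definition kg_block :: "kg_sym list \<times> kg_sym list \<times> kg_sym list \<times> kg_sym list \<Rightarrow> kg_sym list" where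
  "kg_block blk = (case blk of (a, b, e, f) \<Rightarrow>
     [KAll, KLP] @ a @ [KComma] @ b @ [KRP, KEx, KLP] @ e @ [KComma] @ f @ [KRP])"

definition L_KG :: "kg_sym list set" where
  "L_KG = {u. \<exists>S blks. u = S @ concat (map kg_block blks) \<and> is_bin S \<and>
     (\<forall>(a, b, e, f) \<in> set blks. is_bin a \<and> is_bin b \<and> is_bin e \<and> is_bin f) \<and>
     (let n = length blks in
      \<forall>xs. length xs = n \<and>
           (\<forall>i<n. case blks ! i of (a, b, e, f) \<Rightarrow> xs ! i = bin_val a \<or> xs ! i = bin_val b) \<longrightarrow>
        (\<exists>ys. length ys = n \<and>
           (\<forall>i<n. case blks ! i of (a, b, e, f) \<Rightarrow> ys ! i = bin_val e \<or> ys ! i = bin_val f) \<and>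
           bin_val S = (\<Sum>i<n. xs ! i + ys ! i)))}"

text \<open>Deterministic Turing machine transducer: read-only two-way input tape with
end-markers, one work tape over the finite alphabet {0..<tm_nwork} (blank = 0) whose
head starts at cell 0, and a write-only one-way output tape. The transition gives
(new state, input head move, symbol written, work head move, optional output symbol).\<close>

record ('a, 'b) tm =
  tm_nstates :: nat
  tm_nwork :: nat
  tm_start :: nat
  tm_final :: "nat set"
  tm_delta :: "nat \<Rightarrow> 'a tsym \<Rightarrow> nat \<Rightarrow> nat \<times> int \<times> nat \<times> int \<times> 'b option"

type_synonym 'b tm_config = "nat \<times> nat \<times> (nat \<Rightarrow> nat) \<times> nat \<times> 'b list"

definition wf_tm :: "('a, 'b) tm \<Rightarrow> bool" where
  "wf_tm M \<longleftrightarrow> tm_start M < tm_nstates M \<and> tm_final M \<subseteq> {..<tm_nstates M} \<and> 0 < tm_nwork M \<and>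
     (\<forall>q<tm_nstates M. q \<notin> tm_final M \<longrightarrow> (\<forall>\<sigma>. \<forall>s<tm_nwork M.
        case tm_delta M q \<sigma> s of (q', di, s', dw, ob) \<Rightarrow>
          q' < tm_nstates M \<and> s' < tm_nwork M \<and> di \<in> {-1, 0, 1} \<and> dw \<in> {-1, 0, 1} \<and>
          (\<sigma> = LEnd \<longrightarrow> di \<noteq> -1) \<and> (\<sigma> = REnd \<longrightarrow> di \<noteq> 1)))"

definition tm_step :: "('a, 'b) tm \<Rightarrow> 'a list \<Rightarrow> 'b tm_config \<Rightarrow> 'b tm_config" where
  "tm_step M w c = (case c of (q, ih, wt, wh, out) \<Rightarrow>
     if q \<in> tm_final M then c else
     (case tm_delta M q (tape w ih) (wt wh) of (q', di, s', dw, ob) \<Rightarrow>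
       (q', nat (int ih + di), wt(wh := s'), nat (int wh + dw),
        out @ (case ob of None \<Rightarrow> [] | Some b \<Rightarrow> [b]))))"

definition tm_run :: "('a, 'b) tm \<Rightarrow> 'a list \<Rightarrow> nat \<Rightarrow> 'b tm_config" where
  "tm_run M w t = (tm_step M w ^^ t) (tm_start M, 0, (\<lambda>_. 0), 0, [])"

definition tm_computes_in_space :: "('a, 'b) tm \<Rightarrow> ('a list \<Rightarrow> 'b list) \<Rightarrow> (nat \<Rightarrow> nat) \<Rightarrow> bool" where
  "tm_computes_in_space M f s \<longleftrightarrow> (\<forall>w. \<exists>t.
     (case tm_run M w t of (q, ih, wt, wh, out) \<Rightarrow> q \<in> tm_final M \<and> out = f w) \<and>
     (\<forall>t'\<le>t. (case tm_run M w t' of (q, ih, wt, wh, out) \<Rightarrow> wh < s (length w))))"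

definition linear_space_computable :: "('a list \<Rightarrow> 'b list) \<Rightarrow> bool" where
  "linear_space_computable f \<longleftrightarrow>
     (\<exists>(M :: ('a, 'b) tm) (c :: nat). wf_tm M \<and> tm_computes_in_space M f (\<lambda>n. c * (n + 1)))"

definition linear_space_reducible :: "'a list set \<Rightarrow> 'b list set \<Rightarrow> bool" where
  "linear_space_reducible L L' \<longleftrightarrow>
     (\<exists>f. linear_space_computable f \<and> (\<forall>w. w \<in> L \<longleftrightarrow> f w \<in> L'))"

text \<open>Operation on one affine register in one step: apply a rational affine matrix
(M j l = entry in row j, column l) or weight (measure) the register.\<close>
datatype reg_op = Apply "nat \<Rightarrow> nat \<Rightarrow> rat" | Weigh

text \<open>States are {0..<v_nstates}; the prover's messages are from {0..<v_ncomm};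
registers are 0..<v_nregs, register i has dimension v_dim i.
In each step, in state q reading tape symbol sigma and having received message gamma
from the prover, the verifier applies v_ops q sigma gamma i to register i;
the outcome list os records, per register, None (operator applied) or Some j
(weighting observed basis state j); then the new state and head move are
v_trans q sigma gamma os.\<close>

record 'a adfa =
  v_nstates :: nat
  v_ncomm :: nat
  v_nregs :: nat
  v_dim :: "nat \<Rightarrow> nat"
  v_init :: "nat \<Rightarrow> nat \<Rightarrow> rat"
  v_start :: nat
  v_acc :: "nat set"
  v_rej :: "nat set"
  v_ops :: "nat \<Rightarrow> 'a tsym \<Rightarrow> nat \<Rightarrow> nat \<Rightarrow> reg_op"
  v_trans :: "nat \<Rightarrow> 'a tsym \<Rightarrow> nat \<Rightarrow> nat option list \<Rightarrow> nat \<times> int"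

definition affine_vec :: "nat \<Rightarrow> (nat \<Rightarrow> rat) \<Rightarrow> bool" where
  "affine_vec d v \<longleftrightarrow> (\<Sum>j<d. v j) = 1"

definition affine_matrix :: "nat \<Rightarrow> (nat \<Rightarrow> nat \<Rightarrow> rat) \<Rightarrow> bool" where
  "affine_matrix d M \<longleftrightarrow> (\<forall>l<d. (\<Sum>j<d. M j l) = 1)"

definition wf_adfa :: "'a adfa \<Rightarrow> bool" where
  "wf_adfa V \<longleftrightarrow> v_start V < v_nstates V \<and> v_acc V \<subseteq> {..<v_nstates V} \<and>
     v_rej V \<subseteq> {..<v_nstates V} \<and> v_acc V \<inter> v_rej V = {} \<and> 0 < v_ncomm V \<and>
     (\<forall>i<v_nregs V. 0 < v_dim V i \<and> affine_vec (v_dim V i) (v_init V i)) \<and>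
     (\<forall>q<v_nstates V. \<forall>\<sigma>. \<forall>\<gamma><v_ncomm V. \<forall>i<v_nregs V.
        case v_ops V q \<sigma> \<gamma> i of Apply M \<Rightarrow> affine_matrix (v_dim V i) M | Weigh \<Rightarrow> True) \<and>
     (\<forall>q<v_nstates V. \<forall>\<sigma> \<gamma> os. case v_trans V q \<sigma> \<gamma> os of (q', d) \<Rightarrow>
        q' < v_nstates V \<and> d \<in> {-1, 0, 1} \<and> (\<sigma> = LEnd \<longrightarrow> d \<noteq> -1) \<and> (\<sigma> = REnd \<longrightarrow> d \<noteq> 1))"

type_synonym regs = "nat \<Rightarrow> nat \<Rightarrow> real"

definition init_regs :: "'a adfa \<Rightarrow> regs" where
  "init_regs V = (\<lambda>i j. if i < v_nregs V \<and> j < v_dim V i then of_rat (v_init V i j) else 0)"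

definition outcomes :: "'a adfa \<Rightarrow> nat \<Rightarrow> 'a tsym \<Rightarrow> nat \<Rightarrow> nat option list set" where
  "outcomes V q \<sigma> \<gamma> = {os. length os = v_nregs V \<and> (\<forall>i<v_nregs V.
     case v_ops V q \<sigma> \<gamma> i of Apply _ \<Rightarrow> os ! i = None | Weigh \<Rightarrow> (\<exists>j<v_dim V i. os ! i = Some j))}"

definition l1norm :: "nat \<Rightarrow> (nat \<Rightarrow> real) \<Rightarrow> real" where
  "l1norm d v = (\<Sum>j<d. \<bar>v j\<bar>)"

text \<open>Weighting observes e_j with probability |v_j| / ||v||_1; weightings of distinct
registers are independent.\<close>
definition outcome_prob :: "'a adfa \<Rightarrow> regs \<Rightarrow> nat option list \<Rightarrow> real" where
  "outcome_prob V r os = (\<Prod>i<v_nregs V. case os ! i of None \<Rightarrow> 1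
       | Some j \<Rightarrow> \<bar>r i j\<bar> / l1norm (v_dim V i) (r i))"

definition upd_regs :: "'a adfa \<Rightarrow> nat \<Rightarrow> 'a tsym \<Rightarrow> nat \<Rightarrow> regs \<Rightarrow> nat option list \<Rightarrow> regs" where
  "upd_regs V q \<sigma> \<gamma> r os = (\<lambda>i j. if i < v_nregs V \<and> j < v_dim V i then
     (case v_ops V q \<sigma> \<gamma> i of
        Apply M \<Rightarrow> (\<Sum>l<v_dim V i. of_rat (M j l) * r i l)
      | Weigh \<Rightarrow> (if os ! i = Some j then 1 else 0))
     else 0)"

text \<open>A (deterministic) prover: as the coins are public it sees the whole history of
weighting outcomes (from which, together with the input, the verifier's states, head
positions and register contents are determined) and sends a message.\<close>
type_synonym prover = "nat option list list \<Rightarrow> nat"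

definition valid_prover :: "'a adfa \<Rightarrow> prover \<Rightarrow> bool" where
  "valid_prover V P \<longleftrightarrow> (\<forall>hist. P hist < v_ncomm V)"

primrec halt_prob :: "nat \<Rightarrow> nat set \<Rightarrow> 'a adfa \<Rightarrow> 'a list \<Rightarrow> prover \<Rightarrow>
    nat option list list \<Rightarrow> nat \<Rightarrow> nat \<Rightarrow> regs \<Rightarrow> real" where
  "halt_prob 0 T V w P hist q h r = (if q \<in> T then 1 else 0)"
| "halt_prob (Suc t) T V w P hist q h r =
     (if q \<in> v_acc V \<union> v_rej V then (if q \<in> T then 1 else 0) else
      (let \<sigma> = tape w h; \<gamma> = P hist in
       \<Sum>os \<in> outcomes V q \<sigma> \<gamma>. outcome_prob V r os *
         (case v_trans V q \<sigma> \<gamma> os of (q', d) \<Rightarrow>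
            halt_prob t T V w P (hist @ [os]) q' (nat (int h + d)) (upd_regs V q \<sigma> \<gamma> r os))))"

definition acc_prob :: "'a adfa \<Rightarrow> 'a list \<Rightarrow> prover \<Rightarrow> real" where
  "acc_prob V w P = (SUP t. halt_prob t (v_acc V) V w P [] (v_start V) 0 (init_regs V))"

definition rej_prob :: "'a adfa \<Rightarrow> 'a list \<Rightarrow> prover \<Rightarrow> real" where
  "rej_prob V w P = (SUP t. halt_prob t (v_rej V) V w P [] (v_start V) 0 (init_regs V))"

definition AM_verifies :: "'a adfa \<Rightarrow> 'a list set \<Rightarrow> rat \<Rightarrow> bool" where
  "AM_verifies V L eps \<longleftrightarrow> wf_adfa V \<and>
     (\<forall>w\<in>L. \<exists>P. valid_prover V P \<and> acc_prob V w P \<ge> 1 - of_rat eps) \<and>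
     (\<forall>w. w \<notin> L \<longrightarrow> (\<forall>P. valid_prover V P \<longrightarrow> rej_prob V w P \<ge> 1 - of_rat eps))"

definition perfect_completeness :: "'a adfa \<Rightarrow> 'a list set \<Rightarrow> bool" where
  "perfect_completeness V L \<longleftrightarrow> (\<forall>w\<in>L. \<exists>P. valid_prover V P \<and> acc_prob V w P = 1)"

end

theory Submission
  imports Defs
begin

text \<open>
  The verifier keeps the work tape of the reducing Turing machine as a base-\<open>B\<close> number \<open>W\<close> in one affine
  register, together with \<open>P = B ^ h\<close> for the work head position \<open>h\<close>, and lets its own head follow the
  input head of the machine. In every step the prover claims the scanned work symbol. With high
  probability the verifier then checks the claim: it sweeps over the input while the prover spells out
  the tape, and weighs the differences between \<open>W\<close>, \<open>P\<close> and the numbers spelled out, scaled so that a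
  non-zero difference leads to rejection with probability close to 1; if nothing is wrong it starts all over.
  Otherwise it takes the claim for granted and continues.

  A round simulates the machine twice. In the first pass coins select the universal numbers, in the
  second pass the prover selects the existential ones, and the register accumulates the target minus
  the selected numbers. At the end of the round a non-zero result leads to rejection with probability close to 1,
  and a zero result to acceptance with a probability \<open>A\<close> that is halved in every simulation step, and
  to a restart otherwise. Hence an honest prover is never rejected and wins eventually, while for a
  word outside the language the probability of being accepted in a round, or of never finishing it, is
  small relative to the probability that the coins hit a bad choice of universal numbers.
\<close>

section \<open>Affine registers with five data components\<close>

text \<open>Three obstacles shape the protocol. Weighting destroys the register, so checking a claim
  uses up the round, and a round survives all its steps only with probability exponentially small in
  the running time. This is harmless: a restart restores the initial configuration, so only the
  ratio between winning and losing within one round counts. The finite control does not know the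
  running time, hence the halving of \<open>A\<close>: each step continues on two coin outcomes of
  weight \<open>eta\<close>, and the halving cancels this factor 2. After \<open>k\<close> steps the
  total acceptance mass is \<open>eta ^ k * A\<close>, to be compared with the mass
  \<open>eta ^ k\<close> of a single bad branch, whatever \<open>k\<close> is. Two passes are needed
  since the existential numbers may depend on the universal ones of later blocks too, while the
  machine's output cannot be stored. For soundness, the infimum \<open>rej_inf\<close> over all
  provers satisfies an inequality in which it occurs on both sides; for completeness, a prover for
  unboundedly many rounds arises as a fixed point. Missing a check, a check that misses an error,
  and acceptance cost \<open>eps / 4\<close> each.\<close>

definition emb :: "'x::field list \<Rightarrow> nat \<Rightarrow> 'x" where
  "emb d j = (if j = 0 then 1 - (\<Sum>i<5. d ! i) else if j < 6 then d ! (j - 1) else 0)"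

definition lin :: "rat list list \<Rightarrow> real list \<Rightarrow> real list" where
  "lin R d = map (\<lambda>i. \<Sum>l<6. of_rat (R ! i ! l) * (1 # d) ! l) [0..<5]"

text \<open>Component 0 of \<open>emb\<close> is slack that keeps the sum equal to 1. Since the
  entries of an affine vector sum to 1, the constant term of a row is added to all columns; row 0 is
  what the column sums then force. So every rational affine map on the five data components is
  available.\<close>

definition lin_mat :: "rat list list \<Rightarrow> nat \<Rightarrow> nat \<Rightarrow> rat" where
  "lin_mat R j l =
     (let g = (\<lambda>i. R ! i ! 0 + (if l = 0 then 0 else R ! i ! l))
      in case j of 0 \<Rightarrow> 1 - (\<Sum>i<5. g i) | Suc i \<Rightarrow> g i)"

lemma sum_lessThan_6: "(\<Sum>j<(6::nat). f j) = f 0 + (\<Sum>j<5. f (Suc j))" for f :: "nat \<Rightarrow> 'x::ab_group_add"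
proof -
  have "{..<6::nat} = {..<Suc 5}" by simp
  then show ?thesis by (simp only: sum.lessThan_Suc_shift)
qed

lemma sum_emb: "(\<Sum>j<6. emb d j) = 1"
  by (simp add: sum_lessThan_6 emb_def)

lemma affine_lin_mat: "affine_matrix 6 (lin_mat R)"
  by (simp add: affine_matrix_def sum_lessThan_6 lin_mat_def Let_def)

lemma of_rat_emb: "j < 6 \<Longrightarrow> of_rat (emb d j) = (emb (map of_rat d) j :: real)" if "length d = 5"
  using that by (auto simp: emb_def of_rat_diff of_rat_sum)

lemma lin_mat_row:
  "(\<Sum>l<6. of_rat (lin_mat R (Suc i) l) * emb d l) = (lin R d ! i :: real)" if "i < 5"
proof -
  have "(\<Sum>l<6. of_rat (lin_mat R (Suc i) l) * emb d l) =
      (\<Sum>l<6. of_rat (R ! i ! 0) * emb d l + (if l = 0 then 0 else of_rat (R ! i ! l) * emb d l))"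
    by (rule sum.cong) (auto simp: lin_mat_def of_rat_add algebra_simps)
  also have "\<dots> = of_rat (R ! i ! 0) + (\<Sum>l<5. of_rat (R ! i ! Suc l) * d ! l)"
    by (simp add: sum.distrib sum_distrib_left[symmetric] sum_emb)
       (simp add: sum_lessThan_6 emb_def)
  also have "\<dots> = lin R d ! i"
    using that by (simp add: lin_def sum_lessThan_6)
  finally show ?thesis .
qed

lemma lin_mat_emb:
  assumes "j < 6"
  shows "(\<Sum>l<6. of_rat (lin_mat R j l) * emb d l) = (emb (lin R d) j :: real)"
proof (cases j)
  case 0
  have cs: "(\<Sum>j<6. of_rat (lin_mat R j l)) = (1::real)" if "l < 6" for l
  proof -
    have "(\<Sum>j<6. of_rat (lin_mat R j l)) = (of_rat (\<Sum>j<6. lin_mat R j l) :: real)"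
      by (simp add: of_rat_sum)
    with that show ?thesis using affine_lin_mat[of R] by (simp add: affine_matrix_def)
  qed
  have "1 = (\<Sum>l<6. (\<Sum>j<6. of_rat (lin_mat R j l)) * (emb d l :: real))"
    by (simp add: cs sum_emb)
  also have "\<dots> = (\<Sum>j<6. \<Sum>l<6. of_rat (lin_mat R j l) * emb d l)"
    by (subst sum.swap) (simp add: sum_distrib_right)
  also have "\<dots> = (\<Sum>l<6. of_rat (lin_mat R 0 l) * emb d l) + (\<Sum>i<5. lin R d ! i)"
    by (simp add: sum_lessThan_6[of "\<lambda>j. \<Sum>l<6. of_rat (lin_mat R j l) * emb d l"] lin_mat_row
        cong: sum.cong_simp)
  finally show ?thesis using 0 by (simp add: emb_def)
next
  case (Suc i)
  with assms show ?thesis using lin_mat_row[of i R d] by (simp add: emb_def)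
qed

definition unit_data :: "nat \<Rightarrow> real list" where
  "unit_data j = map (\<lambda>i. if j = Suc i then 1 else 0) [0..<5]"

lemma emb_unit_data: "j < 6 \<Longrightarrow> emb (unit_data j) = (\<lambda>i. if i = j then 1 else 0)"
proof
  fix i assume "j < 6"
  have "(\<Sum>i<5. if j = Suc i then 1 else 0::real) = (if j = 0 then 0 else 1)"
    using \<open>j < 6\<close> by (cases j) (auto simp: sum.delta)
  moreover have "(\<Sum>i<5. unit_data j ! i) = (\<Sum>i<5. if j = Suc i then 1 else 0)"
    by (rule sum.cong) (auto simp: unit_data_def)
  ultimately show "emb (unit_data j) i = (if i = j then 1 else 0)"
    using \<open>j < 6\<close> by (auto simp: emb_def unit_data_def)
qed

lemma l1norm_emb_ge_1: "1 \<le> l1norm 6 (emb d)"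
proof -
  have "\<bar>\<Sum>j<6. emb d j\<bar> \<le> (\<Sum>j<6. \<bar>emb d j\<bar>)" by (rule sum_abs)
  then show ?thesis by (simp add: sum_emb l1norm_def)
qed

section \<open>Limits of halting probabilities\<close>

lemma outcome_prob_nonneg: "0 \<le> outcome_prob V r os"
  by (auto simp: outcome_prob_def l1norm_def intro!: prod_nonneg sum_nonneg divide_nonneg_nonneg split: option.split)

text \<open>Past outcomes matter only to the prover, so they can be absorbed into a shifted prover,
  and everything below starts from the empty history.\<close>

lemma halt_prob_append:
  "halt_prob t T V w P (a @ b) q h r = halt_prob t T V w (\<lambda>c. P (a @ c)) b q h r"
  by (induction t arbitrary: b q h r) (auto simp: Let_def split: prod.split intro!: sum.cong)

definition lim_prob :: "nat set \<Rightarrow> 'a adfa \<Rightarrow> 'a list \<Rightarrow> prover \<Rightarrow> nat \<Rightarrow> nat \<Rightarrow> regs \<Rightarrow> real" where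
  "lim_prob T V w P q h r = (SUP t. halt_prob t T V w P [] q h r)"

text \<open>Only an inequality: for a zero register the norm is 0 and all quotients by it are 0 in
  HOL, so equality would fail for arbitrary \<open>r\<close>.\<close>

locale sub_adfa =
  fixes V :: "'a adfa"
  assumes sum_outcomes: "\<And>q \<sigma> \<gamma> r. (\<Sum>os\<in>outcomes V q \<sigma> \<gamma>. outcome_prob V r os) \<le> 1"
begin

lemma halt_prob_nonneg: "0 \<le> halt_prob t T V w P b q h r"
  by (induction t arbitrary: b q h r)
     (auto simp: Let_def outcome_prob_nonneg split: prod.split intro!: sum_nonneg)

lemma halt_prob_le_1: "halt_prob t T V w P b q h r \<le> 1"
proof (induction t arbitrary: b q h r)
  case (Suc t)
  have "(\<Sum>os\<in>outcomes V q \<sigma> \<gamma>. outcome_prob V r os * (case v_trans V q \<sigma> \<gamma> os of (q', k) \<Rightarrow>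
      halt_prob t T V w P (b @ [os]) q' (nat (int h + k)) (upd_regs V q \<sigma> \<gamma> r os))) \<le> 1"
    (is "?l \<le> 1") for \<sigma> \<gamma>
  proof -
    have "?l \<le> (\<Sum>os\<in>outcomes V q \<sigma> \<gamma>. outcome_prob V r os)"
      by (rule sum_mono)
         (auto intro!: mult_left_le Suc.IH outcome_prob_nonneg split: prod.split)
    with sum_outcomes show ?thesis by (rule order_trans[rotated])
  qed
  then show ?case by (auto simp: Let_def)
qed simp

lemma halt_prob_Suc_mono:
  assumes "T \<subseteq> v_acc V \<union> v_rej V"
  shows "halt_prob t T V w P b q h r \<le> halt_prob (Suc t) T V w P b q h r"
proof (induction t arbitrary: b q h r)
  case 0
  show ?case
  proof (cases "q \<in> v_acc V \<union> v_rej V")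
    case False
    with assms have "q \<notin> T" by blast
    then show ?thesis using halt_prob_nonneg[of "Suc 0"] by simp
  qed auto
next
  case (Suc t)
  show ?case
    by (subst halt_prob.simps(2)[of t], subst halt_prob.simps(2)[of "Suc t"])
       (auto simp: Let_def simp del: halt_prob.simps
        intro!: sum_mono mult_left_mono outcome_prob_nonneg Suc.IH split: prod.split)
qed

lemma halt_prob_LIMSEQ:
  assumes "T \<subseteq> v_acc V \<union> v_rej V"
  shows "(\<lambda>t. halt_prob t T V w P [] q h r) \<longlonglongrightarrow> lim_prob T V w P q h r"
  unfolding lim_prob_def
  by (rule LIMSEQ_incseq_SUP)
     (auto intro!: bdd_aboveI2[of _ _ 1] halt_prob_le_1 incseq_SucI halt_prob_Suc_mono assms)

lemma lim_prob_nonneg: "T \<subseteq> v_acc V \<union> v_rej V \<Longrightarrow> 0 \<le> lim_prob T V w P q h r"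
  by (rule LIMSEQ_le_const[OF halt_prob_LIMSEQ]) (auto simp: halt_prob_nonneg)

lemma lim_prob_le_1: "T \<subseteq> v_acc V \<union> v_rej V \<Longrightarrow> lim_prob T V w P q h r \<le> 1"
  by (rule LIMSEQ_le_const2[OF halt_prob_LIMSEQ]) (auto simp: halt_prob_le_1)

lemma lim_prob_halted:
  assumes "T \<subseteq> v_acc V \<union> v_rej V" "q \<in> T"
  shows "lim_prob T V w P q h r = 1"
proof -
  have "halt_prob t T V w P [] q h r = 1" for t
    using assms by (cases t) auto
  then show ?thesis by (simp add: lim_prob_def)
qed

lemma lim_prob_step:
  assumes T: "T \<subseteq> v_acc V \<union> v_rej V" and q: "q \<notin> v_acc V \<union> v_rej V"
    and fin: "finite (outcomes V q (tape w h) (P []))"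
  shows "lim_prob T V w P q h r = (\<Sum>os \<in> outcomes V q (tape w h) (P []). outcome_prob V r os *
         (case v_trans V q (tape w h) (P []) os of (q', k) \<Rightarrow>
            lim_prob T V w (\<lambda>c. P (os # c)) q' (nat (int h + k)) (upd_regs V q (tape w h) (P []) r os)))"
    (is "_ = ?R")
proof -
  have "(\<lambda>t. halt_prob (Suc t) T V w P [] q h r) \<longlonglongrightarrow> lim_prob T V w P q h r"
    by (rule LIMSEQ_Suc[OF halt_prob_LIMSEQ[OF T]])
  moreover have "(\<lambda>t. halt_prob (Suc t) T V w P [] q h r) \<longlonglongrightarrow> ?R"
  proof -
    have *: "halt_prob t T V w P [os] q h r = halt_prob t T V w (\<lambda>c. P (os # c)) [] q h r" for t os q h r
      using halt_prob_append[of t T V w P "[os]" "[]" q h r] by simp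
    show ?thesis
      using q by (auto simp: Let_def * split_def intro!: tendsto_sum tendsto_mult halt_prob_LIMSEQ T)
  qed
  ultimately show ?thesis by (rule LIMSEQ_unique)
qed

end

section \<open>Verifiers with a coin register and a data register\<close>

datatype 's act = Det "rat list list" 's int | Coin "nat \<Rightarrow> 's" | Meas "nat \<Rightarrow> 's"

definition two_regs :: "(nat \<Rightarrow> real) \<Rightarrow> (nat \<Rightarrow> real) \<Rightarrow> regs" where
  "two_regs x y = (\<lambda>i. if i = 0 then x else if i = 1 then y else (\<lambda>_. 0))"

lemma lessThan_2: "{..<2::nat} = {0, 1}" by auto
lemma lessThan_3: "{..<3::nat} = {0, 1, 2}" by auto

lemma list_length_2: "length xs = 2 \<longleftrightarrow> (\<exists>a b. xs = [a, b])"
  by (auto simp: numeral_2_eq_2 length_Suc_conv)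

text \<open>Weighting leaves a basis state in the coin register. A toss leads out of
  \<open>coin\<close>, so a step that refills this register always precedes the next toss.\<close>

locale protocol =
  fixes Q :: "'s set" and G :: "'m set" and act :: "'s \<Rightarrow> 'a tsym \<Rightarrow> 'm \<Rightarrow> 's act"
    and s0 sacc srej :: 's and coin :: "'s set" and eta :: rat and d0 :: "rat list"
  assumes finite_Q: "finite Q" and Q: "s0 \<in> Q" "sacc \<in> Q" "srej \<in> Q" and acc_rej: "sacc \<noteq> srej"
    and finite_G: "finite G" and G: "G \<noteq> {}"
    and eta: "0 < eta" "2 * eta < 1" and d0: "length d0 = 5"
    and act_Det: "\<And>s \<sigma> m R s' k. s \<in> Q \<Longrightarrow> m \<in> G \<Longrightarrow> act s \<sigma> m = Det R s' k \<Longrightarrow>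
      s' \<in> Q \<and> k \<in> {-1, 0, 1} \<and> (\<sigma> = LEnd \<longrightarrow> k \<noteq> -1) \<and> (\<sigma> = REnd \<longrightarrow> k \<noteq> 1)"
    and act_Coin: "\<And>s \<sigma> m f j. s \<in> Q \<Longrightarrow> m \<in> G \<Longrightarrow> act s \<sigma> m = Coin f \<Longrightarrow> s \<in> coin \<and> f j \<in> Q - coin"
    and act_Meas: "\<And>s \<sigma> m f j. s \<in> Q \<Longrightarrow> m \<in> G \<Longrightarrow> act s \<sigma> m = Meas f \<Longrightarrow> f j \<in> Q"
begin

definition enc :: "'s \<Rightarrow> nat" where "enc = (SOME f. bij_betw f Q {..<card Q})"
definition dec :: "nat \<Rightarrow> 's" where "dec = inv_into Q enc"
definition encm :: "'m \<Rightarrow> nat" where "encm = (SOME f. bij_betw f G {..<card G})"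
text \<open>Total on purpose: \<open>wf_adfa\<close> constrains \<open>v_trans\<close> also for
  messages outside the range.\<close>

definition decm :: "nat \<Rightarrow> 'm" where
  "decm \<gamma> = (if \<gamma> < card G then inv_into G encm \<gamma> else SOME m. m \<in> G)"

lemma bij_enc: "bij_betw enc Q {..<card Q}"
  unfolding enc_def using ex_bij_betw_finite_nat[OF finite_Q]
  by (metis (no_types, lifting) lessThan_atLeast0 someI_ex)

lemma bij_encm: "bij_betw encm G {..<card G}"
  unfolding encm_def using ex_bij_betw_finite_nat[OF finite_G]
  by (metis (no_types, lifting) lessThan_atLeast0 someI_ex)

lemma dec_enc [simp]: "s \<in> Q \<Longrightarrow> dec (enc s) = s"
  using bij_enc by (simp add: dec_def bij_betw_def)

lemma dec_in_Q: "q < card Q \<Longrightarrow> dec q \<in> Q"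
  using bij_enc by (metis bij_betw_def dec_def inv_into_into lessThan_iff)

lemma enc_less: "s \<in> Q \<Longrightarrow> enc s < card Q"
  using bij_enc by (auto simp: bij_betw_def)

lemma enc_eq: "s \<in> Q \<Longrightarrow> s' \<in> Q \<Longrightarrow> enc s = enc s' \<longleftrightarrow> s = s'"
  using bij_enc by (auto simp: bij_betw_def inj_on_def)

lemma decm_encm [simp]: "m \<in> G \<Longrightarrow> decm (encm m) = m"
  using bij_encm by (auto simp: decm_def bij_betw_def)

lemma decm_in_G: "decm \<gamma> \<in> G"
  using bij_encm G by (auto simp: decm_def bij_betw_def some_in_eq intro: inv_into_into)

lemma encm_less: "m \<in> G \<Longrightarrow> encm m < card G"
  using bij_encm by (auto simp: bij_betw_def)

definition coin_vec :: "nat \<Rightarrow> rat" where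
  "coin_vec j = (if j = 0 then 1 - 2 * eta else if j < 3 then eta else 0)"

definition fair :: "nat \<Rightarrow> real" where "fair j = of_rat (coin_vec j)"

text \<open>The matrix whose columns all equal \<open>coin_vec\<close> maps every vector of sum 1 to
  \<open>coin_vec\<close>; each step other than a toss refills the coin register in this
  way.\<close>

definition ver_ops :: "nat \<Rightarrow> 'a tsym \<Rightarrow> nat \<Rightarrow> nat \<Rightarrow> reg_op" where
  "ver_ops q \<sigma> \<gamma> i = (case act (dec q) \<sigma> (decm \<gamma>) of
     Det R _ _ \<Rightarrow> if i = 0 then Apply (\<lambda>j _. coin_vec j) else Apply (lin_mat R)
   | Coin _ \<Rightarrow> if i = 0 then Weigh else Apply (\<lambda>j l. if j = l then 1 else 0)
   | Meas _ \<Rightarrow> if i = 0 then Apply (\<lambda>j _. coin_vec j) else Weigh)"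

definition ver_trans :: "nat \<Rightarrow> 'a tsym \<Rightarrow> nat \<Rightarrow> nat option list \<Rightarrow> nat \<times> int" where
  "ver_trans q \<sigma> \<gamma> os = (case act (dec q) \<sigma> (decm \<gamma>) of
     Det _ s k \<Rightarrow> (enc s, k)
   | Coin f \<Rightarrow> (enc (f (the (os ! 0))), 0)
   | Meas f \<Rightarrow> (enc (f (the (os ! 1))), 0))"

definition ver :: "'a adfa" where
  "ver = \<lparr>v_nstates = card Q, v_ncomm = card G, v_nregs = 2, v_dim = (\<lambda>i. if i = 0 then 3 else 6),
     v_init = (\<lambda>i. if i = 0 then coin_vec else emb d0), v_start = enc s0,
     v_acc = {enc sacc}, v_rej = {enc srej}, v_ops = ver_ops, v_trans = ver_trans\<rparr>"

lemma ver_simps [simp]: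
  "v_nstates ver = card Q" "v_ncomm ver = card G" "v_nregs ver = 2"
  "v_dim ver i = (if i = 0 then 3 else 6)"
  "v_init ver i = (if i = 0 then coin_vec else emb d0)"
  "v_start ver = enc s0" "v_acc ver = {enc sacc}" "v_rej ver = {enc srej}"
  "v_ops ver = ver_ops" "v_trans ver = ver_trans"
  by (simp_all add: ver_def)

lemma sum_coin_vec: "(\<Sum>j<3. coin_vec j) = 1"
  by (simp add: coin_vec_def lessThan_3)

lemma sum_fair: "(\<Sum>j<3. fair j) = 1"
  using sum_coin_vec by (metis fair_def of_rat_1 of_rat_sum sum.cong)

lemma fair_simps:
  "fair 0 = 1 - 2 * of_rat eta" "fair (Suc 0) = of_rat eta" "fair 2 = of_rat eta"
  by (simp_all add: fair_def coin_vec_def of_rat_diff of_rat_mult)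

lemma fair_nonneg: "0 \<le> fair j"
  using eta by (auto simp: fair_def coin_vec_def)

lemma wf_ver: "wf_adfa ver"
proof -
  have "card G > 0" using finite_G G by (simp add: card_gt_0_iff)
  moreover have "enc sacc \<noteq> enc srej" using Q acc_rej by (simp add: enc_eq)
  moreover have "affine_vec 3 coin_vec" "affine_vec 6 (emb d0)"
    using sum_coin_vec by (auto simp: affine_vec_def sum_emb)
  moreover have "affine_matrix 3 (\<lambda>j _. coin_vec j)" using sum_coin_vec by (simp add: affine_matrix_def)
  moreover have "affine_matrix 6 (\<lambda>j l. if j = l then 1 else 0)" by (simp add: affine_matrix_def sum.delta')
  moreover have "case ver_trans q \<sigma> \<gamma> os of (q', k) \<Rightarrow>
      q' < card Q \<and> k \<in> {-1, 0, 1} \<and> (\<sigma> = LEnd \<longrightarrow> k \<noteq> -1) \<and> (\<sigma> = REnd \<longrightarrow> k \<noteq> 1)"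
    if "q < card Q" for q \<sigma> \<gamma> os
    using act_Det[OF dec_in_Q[OF that] decm_in_G] act_Coin[OF dec_in_Q[OF that] decm_in_G]
      act_Meas[OF dec_in_Q[OF that] decm_in_G]
    by (auto simp: ver_trans_def enc_less split: act.split)
  ultimately show ?thesis
    using Q by (auto simp: wf_adfa_def enc_less ver_ops_def affine_lin_mat split: act.split)
qed

lemma outcomes_ver:
  "outcomes ver q \<sigma> \<gamma> = (case act (dec q) \<sigma> (decm \<gamma>) of Det _ _ _ \<Rightarrow> {[None, None]}
     | Coin _ \<Rightarrow> (\<lambda>j. [Some j, None]) ` {..<3} | Meas _ \<Rightarrow> (\<lambda>j. [None, Some j]) ` {..<6})"
proof -
  have all2: "(\<forall>i<2::nat. A i) \<longleftrightarrow> A 0 \<and> A 1" for A by (auto simp: less_2_cases_iff)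
  show ?thesis
    by (auto simp: outcomes_def list_length_2 all2 ver_ops_def split: act.split)
qed

lemma outcome_prob_ver [simp]:
  "outcome_prob ver r [None, None] = 1"
  "outcome_prob ver r [Some j, None] = \<bar>r 0 j\<bar> / l1norm 3 (r 0)"
  "outcome_prob ver r [None, Some j] = \<bar>r 1 j\<bar> / l1norm 6 (r 1)"
  by (simp_all add: outcome_prob_def lessThan_2)

lemma inj_outcomes:
  "inj_on (\<lambda>j. [Some j, None]) A" "inj_on (\<lambda>j. [None, Some j]) A"
  by (auto simp: inj_on_def)

sublocale sub_adfa ver
proof
  fix q \<sigma> \<gamma> r
  have *: "(\<Sum>j<n. \<bar>x j\<bar> / l1norm n x) \<le> 1" for n and x :: "nat \<Rightarrow> real"
    by (auto simp: l1norm_def sum_divide_distrib[symmetric] divide_self_if)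
  show "(\<Sum>os\<in>outcomes ver q \<sigma> \<gamma>. outcome_prob ver r os) \<le> 1"
    using *[of "r 0" 3] *[of "r 1" 6]
    by (auto simp: outcomes_ver sum.reindex inj_outcomes o_def split: act.split)
qed

lemma finite_outcomes: "finite (outcomes ver q \<sigma> \<gamma>)"
  by (auto simp: outcomes_ver split: act.split)

lemma init_regs_ver: "init_regs ver = two_regs fair (emb (map of_rat d0))"
proof -
  have "coin_vec j = 0" if "\<not> j < 3" for j using that by (simp add: coin_vec_def)
  moreover have "emb (map of_rat d0) j = (0::real)" if "\<not> j < 6" for j
    using that by (simp add: emb_def)
  ultimately show ?thesis
    by (auto simp: init_regs_def two_regs_def fair_def of_rat_emb d0 fun_eq_iff)
qed

definition proper :: "(nat \<Rightarrow> real) \<Rightarrow> 's \<Rightarrow> bool" where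
  "proper x s \<longleftrightarrow> (\<Sum>j<3. x j) = 1 \<and> (s \<in> coin \<longrightarrow> x = fair)"

lemma proper_fair: "proper fair s"
  by (simp add: proper_def sum_fair)

lemma upd_coin_reset:
  assumes "(\<Sum>j<3. x j) = 1" "\<not> (\<exists>f. act (dec q) \<sigma> (decm \<gamma>) = Coin f)"
  shows "upd_regs ver q \<sigma> \<gamma> (two_regs x y) os 0 = fair"
proof
  fix j
  have "(\<Sum>l<3. of_rat (coin_vec j) * x l) = of_rat (coin_vec j)"
    using assms(1) by (simp add: sum_distrib_left[symmetric])
  moreover have "coin_vec j = 0" if "\<not> j < 3" using that by (simp add: coin_vec_def)
  ultimately show "upd_regs ver q \<sigma> \<gamma> (two_regs x y) os 0 j = fair j"
    using assms(2) by (auto simp: upd_regs_def ver_ops_def two_regs_def fair_def split: act.split)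
qed

lemma upd_Det:
  assumes "(\<Sum>j<3. x j) = 1" "act (dec q) \<sigma> (decm \<gamma>) = Det R s' k"
  shows "upd_regs ver q \<sigma> \<gamma> (two_regs x (emb d)) os = two_regs fair (emb (lin R d))"
proof
  fix i
  have "emb (lin R d) j = 0" if "\<not> j < 6" for j using that by (simp add: emb_def)
  then show "upd_regs ver q \<sigma> \<gamma> (two_regs x (emb d)) os i = two_regs fair (emb (lin R d)) i"
    using assms upd_coin_reset[OF assms(1), of q \<sigma> \<gamma> "emb d" os]
    by (cases "i = 0")
       (auto simp: two_regs_def, auto simp: upd_regs_def ver_ops_def lin_mat_emb fun_eq_iff less_2_cases_iff)
qed

lemma upd_Coin:
  assumes "act (dec q) \<sigma> (decm \<gamma>) = Coin f" "j < 3"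
  shows "upd_regs ver q \<sigma> \<gamma> (two_regs x (emb d)) [Some j, None] =
    two_regs (\<lambda>i. if i = j then 1 else 0) (emb d)"
proof (intro ext)
  fix i l
  have [simp]: "(\<Sum>l<6. of_rat (if i = l then 1 else 0) * emb d l) = (if i < 6 then emb d i else 0)" for i
  proof -
    have "(\<Sum>l<6. of_rat (if i = l then 1 else 0) * emb d l) = (\<Sum>l<6. if i = l then emb d l else 0)"
      by (rule sum.cong) auto
    then show ?thesis by (simp add: sum.delta')
  qed
  have [simp]: "\<not> j < 6 \<Longrightarrow> emb d j = 0" for j by (simp add: emb_def)
  show "upd_regs ver q \<sigma> \<gamma> (two_regs x (emb d)) [Some j, None] i l =
      two_regs (\<lambda>i. if i = j then 1 else 0) (emb d) i l"
    using assms by (auto simp: upd_regs_def two_regs_def ver_ops_def)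
qed

lemma upd_Meas:
  assumes "(\<Sum>j<3. x j) = 1" "act (dec q) \<sigma> (decm \<gamma>) = Meas f" "j < 6"
  shows "upd_regs ver q \<sigma> \<gamma> (two_regs x (emb d)) [None, Some j] = two_regs fair (emb (unit_data j))"
proof
  fix i
  show "upd_regs ver q \<sigma> \<gamma> (two_regs x (emb d)) [None, Some j] i = two_regs fair (emb (unit_data j)) i"
    using assms upd_coin_reset[OF assms(1), of q \<sigma> \<gamma> "emb d" "[None, Some j]"]
    by (cases "i = 0")
       (auto simp: two_regs_def, auto simp: upd_regs_def ver_ops_def emb_unit_data fun_eq_iff less_2_cases_iff)
qed

end

section \<open>Protocols on a fixed input, and rejection against every prover\<close>

locale protocol_input = protocol Q G act s0 sacc srej coin eta d0
  for Q :: "'s set" and G :: "'m set" and act :: "'s \<Rightarrow> 'a tsym \<Rightarrow> 'm \<Rightarrow> 's act"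
    and s0 sacc srej :: 's and coin :: "'s set" and eta :: rat and d0 :: "rat list" +
  fixes w :: "'a list"
begin

definition val :: "'s \<Rightarrow> prover \<Rightarrow> 's \<Rightarrow> nat \<Rightarrow> (nat \<Rightarrow> real) \<Rightarrow> real list \<Rightarrow> real" where
  "val T P s h x d = lim_prob {enc T} ver w P (enc s) h (two_regs x (emb d))"

abbreviation valid :: "prover \<Rightarrow> bool" where "valid \<equiv> valid_prover ver"

lemma valid_Cons: "valid P \<Longrightarrow> valid (\<lambda>c. P (os # c))"
  by (simp add: valid_prover_def)

lemma val_bounds: "T \<in> {sacc, srej} \<Longrightarrow> 0 \<le> val T P s h x d" "T \<in> {sacc, srej} \<Longrightarrow> val T P s h x d \<le> 1"
  unfolding val_def by (auto intro!: lim_prob_nonneg lim_prob_le_1)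

lemma val_halted: "T \<in> {sacc, srej} \<Longrightarrow> val T P T h x d = 1"
  unfolding val_def by (auto intro!: lim_prob_halted)

lemma val_step:
  assumes T: "T \<in> {sacc, srej}" and s: "s \<in> Q" "s \<notin> {sacc, srej}" and x: "proper x s"
  shows "val T P s h x d = (case act s (tape w h) (decm (P [])) of
     Det R s' k \<Rightarrow> val T (\<lambda>c. P ([None, None] # c)) s' (nat (int h + k)) fair (lin R d)
   | Coin f \<Rightarrow> (\<Sum>j<3. fair j * val T (\<lambda>c. P ([Some j, None] # c)) (f j) h (\<lambda>i. if i = j then 1 else 0) d)
   | Meas f \<Rightarrow> (\<Sum>j<6. \<bar>emb d j\<bar> / l1norm 6 (emb d) *
        val T (\<lambda>c. P ([None, Some j] # c)) (f j) h fair (unit_data j)))"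
proof -
  have x1: "(\<Sum>j<3. x j) = 1" using x by (simp add: proper_def)
  have dec: "dec (enc s) = s" using s by simp
  have nh: "enc s \<notin> v_acc ver \<union> v_rej ver" using s Q by (auto simp: enc_eq)
  have T': "{enc T} \<subseteq> v_acc ver \<union> v_rej ver" using T by auto
  note step = lim_prob_step[OF T' nh finite_outcomes]
  show ?thesis
  proof (cases "act s (tape w h) (decm (P []))")
    case (Det R s' k)
    then show ?thesis
      using upd_Det[OF x1, of "enc s" "tape w h" "P []" R s' k]
      by (simp add: val_def step outcomes_ver dec ver_trans_def)
  next
    case (Coin f)
    have "x = fair" using x act_Coin[OF s(1) decm_in_G Coin] by (simp add: proper_def)
    moreover have "l1norm 3 fair = 1" using fair_nonneg sum_fair by (simp add: l1norm_def)
    ultimately show ?thesis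
      using Coin upd_Coin[of "enc s" "tape w h" "P []" f]
      by (simp add: val_def step outcomes_ver dec ver_trans_def sum.reindex inj_outcomes o_def)
         (simp add: two_regs_def fair_nonneg)
  next
    case (Meas f)
    then show ?thesis
      using upd_Meas[OF x1, of "enc s" "tape w h" "P []" f]
      by (simp add: val_def step outcomes_ver dec ver_trans_def sum.reindex inj_outcomes o_def)
         (simp add: two_regs_def)
  qed
qed

text \<open>Quantifying over all provers, and thus over all continuations of a prover, turns
  soundness into local bounds that compose step by step.\<close>

definition rej_ge :: "real \<Rightarrow> 's \<Rightarrow> nat \<Rightarrow> real list \<Rightarrow> bool" where
  "rej_ge v s h d \<longleftrightarrow> (\<forall>P x. valid P \<longrightarrow> proper x s \<longrightarrow> v \<le> val srej P s h x d)"

lemma rej_ge_0: "v \<le> 0 \<Longrightarrow> rej_ge v s h d"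
  unfolding rej_ge_def using val_bounds(1)[of srej] by (meson insertI1 insertI2 order_trans)

lemma rej_ge_srej: "v \<le> 1 \<Longrightarrow> rej_ge v srej h d"
  unfolding rej_ge_def by (simp add: val_halted)

lemma proper_unit: "s \<notin> coin \<Longrightarrow> j < 3 \<Longrightarrow> proper (\<lambda>i. if i = j then 1 else 0) s"
  by (simp add: proper_def sum.delta')

lemma rej_ge_step:
  assumes s: "s \<in> Q" "s \<notin> {sacc, srej}"
    and step: "\<And>m. m \<in> G \<Longrightarrow> (case act s (tape w h) m of
      Det R s' k \<Rightarrow> rej_ge v s' (nat (int h + k)) (lin R d)
    | Coin f \<Rightarrow> (\<exists>u. (\<forall>j<3. rej_ge (u j) (f j) h d) \<and>
        v \<le> (1 - 2 * of_rat eta) * u 0 + of_rat eta * u 1 + of_rat eta * u 2)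
    | Meas f \<Rightarrow> (\<exists>u. (\<forall>j<6. rej_ge (u j) (f j) h (unit_data j)) \<and>
        v * l1norm 6 (emb d) \<le> (\<Sum>j<6. \<bar>emb d j\<bar> * u j)))"
  shows "rej_ge v s h d"
  unfolding rej_ge_def
proof (intro allI impI)
  fix P x assume P: "valid P" and x: "proper x s"
  note vs = val_step[of srej, OF _ s x, of P h d]
  note st = step[of "decm (P [])", OF decm_in_G]
  show "v \<le> val srej P s h x d"
  proof (cases "act s (tape w h) (decm (P []))")
    case (Det R s' k)
    then show ?thesis using st vs valid_Cons[OF P] proper_fair by (auto simp: rej_ge_def)
  next
    case (Coin f)
    have nc: "f j \<notin> coin" for j using act_Coin[OF s(1) decm_in_G Coin] by simp
    obtain u where u: "\<forall>j<3. rej_ge (u j) (f j) h d"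
      and v: "v \<le> (1 - 2 * of_rat eta) * u 0 + of_rat eta * u 1 + of_rat eta * u 2"
      using st Coin by auto
    have "v \<le> (\<Sum>j<3. fair j * u j)" using v by (simp add: lessThan_3 fair_simps)
    also have "\<dots> \<le> (\<Sum>j<3. fair j *
        val srej (\<lambda>c. P ([Some j, None] # c)) (f j) h (\<lambda>i. if i = j then 1 else 0) d)"
      using u by (intro sum_mono mult_left_mono fair_nonneg)
        (auto simp: rej_ge_def proper_unit nc valid_Cons[OF P])
    finally show ?thesis using vs Coin by simp
  next
    case (Meas f)
    obtain u where u: "\<forall>j<6. rej_ge (u j) (f j) h (unit_data j)"
      and v: "v * l1norm 6 (emb d) \<le> (\<Sum>j<6. \<bar>emb d j\<bar> * u j)"
      using st Meas by auto
    have pos: "0 < l1norm 6 (emb d)" using l1norm_emb_ge_1[of d] by linarith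
    have "v \<le> (\<Sum>j<6. \<bar>emb d j\<bar> * u j) / l1norm 6 (emb d)"
      using v pos by (simp add: pos_le_divide_eq)
    also have "\<dots> = (\<Sum>j<6. \<bar>emb d j\<bar> / l1norm 6 (emb d) * u j)"
      by (simp add: sum_divide_distrib)
    also have "\<dots> \<le> (\<Sum>j<6. \<bar>emb d j\<bar> / l1norm 6 (emb d) *
        val srej (\<lambda>c. P ([None, Some j] # c)) (f j) h fair (unit_data j))"
      using u pos by (intro sum_mono mult_left_mono)
        (auto simp: rej_ge_def proper_fair valid_Cons[OF P])
    finally show ?thesis using vs Meas by simp
  qed
qed

lemma rej_ge_Det:
  assumes "s \<in> Q" "s \<notin> {sacc, srej}"
    and "\<And>m. m \<in> G \<Longrightarrow> \<exists>R s' k. act s (tape w h) m = Det R s' k \<and> rej_ge v s' (nat (int h + k)) (lin R d)"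
  shows "rej_ge v s h d"
  by (rule rej_ge_step[OF assms(1,2)]) (use assms(3) in fastforce)

lemma rej_ge_Coin:
  assumes "s \<in> Q" "s \<notin> {sacc, srej}"
    and "\<And>m. m \<in> G \<Longrightarrow> \<exists>f u. act s (tape w h) m = Coin f \<and> (\<forall>j<3. rej_ge (u j) (f j) h d) \<and>
        v \<le> (1 - 2 * of_rat eta) * u 0 + of_rat eta * u 1 + of_rat eta * u 2"
  shows "rej_ge v s h d"
  by (rule rej_ge_step[OF assms(1,2)]) (use assms(3) in fastforce)

lemma rej_ge_Meas:
  assumes "s \<in> Q" "s \<notin> {sacc, srej}" and "\<And>m. m \<in> G \<Longrightarrow> act s (tape w h) m = Meas f"
    and "\<And>j. j < 6 \<Longrightarrow> rej_ge (u j) (f j) h (unit_data j)"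
    and "v * l1norm 6 (emb d) \<le> (\<Sum>j<6. \<bar>emb d j\<bar> * u j)"
  shows "rej_ge v s h d"
  by (rule rej_ge_step[OF assms(1,2)]) (use assms(3-5) in fastforce)

text \<open>The value of a restart against the worst prover.\<close>

definition rej_inf :: real where
  "rej_inf = (INF P\<in>Collect valid. rej_prob ver w P)"

lemma rej_prob_val: "rej_prob ver w P = val srej P s0 0 fair (map of_rat d0)"
  by (simp add: rej_prob_def val_def lim_prob_def init_regs_ver)

lemma acc_prob_val: "acc_prob ver w P = val sacc P s0 0 fair (map of_rat d0)"
  by (simp add: acc_prob_def val_def lim_prob_def init_regs_ver)

lemma bdd_below_rej: "bdd_below (rej_prob ver w ` Collect valid)"
  by (rule bdd_belowI2[of _ 0]) (simp add: rej_prob_val val_bounds)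

lemma ex_valid: "\<exists>P. valid P"
proof -
  obtain m where "m \<in> G" using G by blast
  then show ?thesis by (intro exI[of _ "\<lambda>_. encm m"]) (simp add: valid_prover_def encm_less)
qed

lemma rej_inf_le: "valid P \<Longrightarrow> rej_inf \<le> rej_prob ver w P"
  unfolding rej_inf_def by (rule cINF_lower[OF bdd_below_rej]) simp

lemma rej_inf_bounds: "0 \<le> rej_inf" "rej_inf \<le> 1"
proof -
  show "0 \<le> rej_inf" unfolding rej_inf_def using ex_valid
    by (intro cINF_greatest) (auto simp: rej_prob_val val_bounds)
  obtain P where "valid P" using ex_valid ..
  then show "rej_inf \<le> 1" using rej_inf_le[of P] val_bounds(2)[of srej P]
    by (metis insertI1 insert_commute order_trans rej_prob_val)
qed

text \<open>A prover that remembers earlier rounds is, from the restart on, just another prover for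
  a fresh start.\<close>

lemma rej_ge_start:
  assumes "s0 \<in> coin"
  shows "rej_ge rej_inf s0 0 (map of_rat d0)"
  unfolding rej_ge_def using assms rej_inf_le by (auto simp: proper_def rej_prob_val)

lemma rej_ge_start_le: "rej_ge v s0 0 (map of_rat d0) \<Longrightarrow> v \<le> rej_inf"
  unfolding rej_inf_def rej_ge_def using ex_valid proper_fair
  by (intro cINF_greatest) (auto simp: rej_prob_val)

section \<open>Never-rejected strategies across restarts\<close>

definition agree :: "nat \<Rightarrow> prover \<Rightarrow> prover \<Rightarrow> bool" where
  "agree n P P' \<longleftrightarrow> (\<forall>c. length c < n \<longrightarrow> P c = P' c)"

text \<open>A strategy that is never rejected, wins with probability at least \<open>p\<close>, and otherwise hands over to
  the prover \<open>P\<close> in the start configuration. The map \<open>F\<close> from \<open>P\<close> to the composed prover is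
  non-expansive (\<open>k = 0\<close>) or contractive (\<open>k = 1\<close>) for the prefix metric; in the latter case its fixed
  point plays infinitely many rounds.\<close>
definition handover :: "nat \<Rightarrow> real \<Rightarrow> 's \<Rightarrow> nat \<Rightarrow> real list \<Rightarrow> (prover \<Rightarrow> prover) \<Rightarrow> bool" where
  "handover k p s h d F \<longleftrightarrow> (\<forall>P. valid P \<longrightarrow> valid (F P)) \<and>
     (\<forall>P P' n. agree n P P' \<longrightarrow> agree (n + k) (F P) (F P')) \<and>
     (\<forall>P x. valid P \<longrightarrow> proper x s \<longrightarrow> p + (1 - p) * acc_prob ver w P \<le> val sacc (F P) s h x d)"

definition acc_ge :: "nat \<Rightarrow> real \<Rightarrow> 's \<Rightarrow> nat \<Rightarrow> real list \<Rightarrow> bool" where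
  "acc_ge k p s h d \<longleftrightarrow> (\<exists>F. handover k p s h d F)"

lemma handoverD:
  assumes "handover k p s h d F"
  shows "valid P \<Longrightarrow> valid (F P)" "agree n P P' \<Longrightarrow> agree (n + k) (F P) (F P')"
    "valid P \<Longrightarrow> proper x s \<Longrightarrow> p + (1 - p) * acc_prob ver w P \<le> val sacc (F P) s h x d"
  using assms unfolding handover_def by blast+

lemma acc_ge_weaken:
  assumes "acc_ge k p s h d"
  shows "acc_ge 0 p s h d"
proof -
  obtain F where F: "handover k p s h d F"
    using assms unfolding acc_ge_def by blast
  have "agree (n + 0) (F P) (F P')" if "agree n P P'" for n P P'
    using handoverD(2)[OF F that] by (auto simp: agree_def)
  with F have "handover 0 p s h d F" unfolding handover_def by blast
  then show ?thesis unfolding acc_ge_def by blast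
qed

lemma acc_ge_sacc: "acc_ge 0 1 sacc h d"
  unfolding acc_ge_def handover_def by (rule exI[of _ "\<lambda>P. P"]) (simp add: val_halted)

lemma acc_ge_start:
  assumes "s0 \<in> coin"
  shows "acc_ge 0 0 s0 0 (map of_rat d0)"
  unfolding acc_ge_def handover_def using assms
  by (intro exI[of _ "\<lambda>P. P"]) (auto simp: acc_prob_val proper_def)

text \<open>The composed prover \<open>H\<close> sends \<open>m\<close> first and plays
  \<open>F os\<close> after the outcome \<open>os\<close>. Its first message does not depend on
  \<open>P\<close>, which is where the gain of one in the prefix metric comes from.\<close>

lemma acc_ge_step_aux:
  assumes s: "s \<in> Q" "s \<notin> {sacc, srej}" and m: "m \<in> G"
    and F: "\<And>os P. valid P \<Longrightarrow> valid (F os P)"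
      "\<And>os P P' n. agree n P P' \<Longrightarrow> agree n (F os P) (F os P')"
    and val: "\<And>P x. valid P \<Longrightarrow> proper x s \<Longrightarrow> p + (1 - p) * acc_prob ver w P \<le>
      (case act s (tape w h) m of
        Det R s' k \<Rightarrow> val sacc (F [None, None] P) s' (nat (int h + k)) fair (lin R d)
      | Coin f \<Rightarrow> (\<Sum>j<3. fair j * val sacc (F [Some j, None] P) (f j) h (\<lambda>i. if i = j then 1 else 0) d)
      | Meas f \<Rightarrow> (\<Sum>j<6. \<bar>emb d j\<bar> / l1norm 6 (emb d) *
            val sacc (F [None, Some j] P) (f j) h fair (unit_data j)))"
  shows "acc_ge 1 p s h d"
proof -
  define H where "H P c = (case c of [] \<Rightarrow> encm m | os # c' \<Rightarrow> F os P c')" for P :: prover and c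
  have H_Cons: "(\<lambda>c. H P (os # c)) = F os P" for P os by (simp add: H_def)
  have H_Nil: "decm (H P []) = m" for P using m by (simp add: H_def)
  show ?thesis unfolding acc_ge_def handover_def
  proof (intro exI[of _ H] conjI allI impI)
    fix P assume "valid P"
    then show "valid (H P)" using F(1)[of P] m
      by (auto simp: valid_prover_def H_def encm_less split: list.split)
  next
    fix P P' n assume *: "agree n P P'"
    show "agree (n + 1) (H P) (H P')" unfolding agree_def
    proof (intro allI impI)
      fix c :: "nat option list list" assume "length c < n + 1"
      then show "H P c = H P' c" using F(2)[OF *] by (cases c) (auto simp: H_def agree_def)
    qed
  next
    fix P x assume "valid P" "proper x s"
    from val[OF this] show "p + (1 - p) * acc_prob ver w P \<le> val sacc (H P) s h x d"
      using val_step[OF _ s \<open>proper x s\<close>, of sacc "H P" h d, unfolded H_Cons H_Nil] by simp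
  qed
qed

lemma acc_ge_Det:
  assumes s: "s \<in> Q" "s \<notin> {sacc, srej}" and m: "m \<in> G" and act: "act s (tape w h) m = Det R s' k"
    and nxt: "acc_ge 0 p s' (nat (int h + k)) (lin R d)"
  shows "acc_ge 1 p s h d"
proof -
  obtain F where F: "handover 0 p s' (nat (int h + k)) (lin R d) F"
    using nxt unfolding acc_ge_def by blast
  show ?thesis
    by (rule acc_ge_step_aux[OF s m, of "\<lambda>_. F"])
       (use handoverD[OF F] act in \<open>auto simp: proper_fair\<close>)
qed

text \<open>The bound \<open>p + (1 - p) * a\<close> is affine in \<open>p\<close>, so averaging
  over the outcomes just averages the \<open>p\<close>.\<close>

lemma acc_ge_Coin:
  assumes s: "s \<in> Q" "s \<notin> {sacc, srej}" and m: "m \<in> G" and act: "act s (tape w h) m = Coin f"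
    and nxt: "acc_ge 0 (p (0::nat)) (f 0) h d" "acc_ge 0 (p 1) (f 1) h d" "acc_ge 0 (p 2) (f 2) h d"
  shows "acc_ge 1 ((1 - 2 * of_rat eta) * p 0 + of_rat eta * p 1 + of_rat eta * p 2) s h d"
proof -
  have "\<forall>j\<in>{..<3}. \<exists>F. handover 0 (p j) (f j) h d F"
    using nxt unfolding acc_ge_def by (auto simp: lessThan_3)
  then obtain F where "\<forall>j\<in>{..<3}. handover 0 (p j) (f j) h d (F j)"
    unfolding bchoice_iff by blast
  then have F: "handover 0 (p j) (f j) h d (F j)" if "j < 3" for j using that by simp
  define F' where "F' os = (if the (os ! 0) < 3 then F (the (os ! 0)) else (\<lambda>P. P))" for os
  show ?thesis
  proof (rule acc_ge_step_aux[OF s m, of F'])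
    fix P x assume P: "valid P" and "proper x s"
    let ?a = "acc_prob ver w P"
    have nc: "f j \<notin> coin" for j using act_Coin[OF s(1) m act] by simp
    have "(\<Sum>j<3. fair j * (p j + (1 - p j) * ?a)) \<le>
        (\<Sum>j<3. fair j * val sacc (F' [Some j, None] P) (f j) h (\<lambda>i. if i = j then 1 else 0) d)"
      by (intro sum_mono mult_left_mono fair_nonneg) (auto simp: F'_def P proper_unit nc intro!: handoverD(3)[OF F])
    moreover have "(\<Sum>j<3. fair j * (p j + (1 - p j) * ?a)) =
        (1 - 2 * of_rat eta) * p 0 + of_rat eta * p 1 + of_rat eta * p 2 +
        (1 - ((1 - 2 * of_rat eta) * p 0 + of_rat eta * p 1 + of_rat eta * p 2)) * ?a"
      by (simp add: lessThan_3 fair_simps algebra_simps)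
    ultimately show "(1 - 2 * of_rat eta) * p 0 + of_rat eta * p 1 + of_rat eta * p 2 +
        (1 - ((1 - 2 * of_rat eta) * p 0 + of_rat eta * p 1 + of_rat eta * p 2)) * ?a \<le>
      (case act s (tape w h) m of
        Det R s' k \<Rightarrow> val sacc (F' [None, None] P) s' (nat (int h + k)) fair (lin R d)
      | Coin f \<Rightarrow> (\<Sum>j<3. fair j * val sacc (F' [Some j, None] P) (f j) h (\<lambda>i. if i = j then 1 else 0) d)
      | Meas f \<Rightarrow> (\<Sum>j<6. \<bar>emb d j\<bar> / l1norm 6 (emb d) *
            val sacc (F' [None, Some j] P) (f j) h fair (unit_data j)))"
      using act by simp
  qed (use handoverD[OF F] in \<open>auto simp: F'_def\<close>)
qed

lemma acc_ge_Meas: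
  assumes s: "s \<in> Q" "s \<notin> {sacc, srej}" and m: "m \<in> G" and act: "act s (tape w h) m = Meas f"
    and nxt: "\<And>j. j < 6 \<Longrightarrow> emb d j \<noteq> 0 \<Longrightarrow> acc_ge 0 (p j) (f j) h (unit_data j)"
  shows "acc_ge 1 ((\<Sum>j<6. \<bar>emb d j\<bar> * p j) / l1norm 6 (emb d)) s h d"
proof -
  let ?J = "{j. j < 6 \<and> emb d j \<noteq> 0}" and ?n = "l1norm 6 (emb d)"
  let ?p = "(\<Sum>j<6. \<bar>emb d j\<bar> * p j) / ?n"
  have "\<forall>j\<in>?J. \<exists>F. handover 0 (p j) (f j) h (unit_data j) F"
    using nxt unfolding acc_ge_def by auto
  then obtain F where "\<forall>j\<in>?J. handover 0 (p j) (f j) h (unit_data j) (F j)"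
    unfolding bchoice_iff by blast
  then have F: "handover 0 (p j) (f j) h (unit_data j) (F j)" if "j \<in> ?J" for j using that by simp
  \<comment> \<open>Outcomes of weight 0 come without a strategy; the identity is a harmless default
    there.\<close>
  define F' where "F' os = (if the (os ! 1) \<in> ?J then F (the (os ! 1)) else (\<lambda>P. P))" for os
  have pos: "0 < ?n" using l1norm_emb_ge_1[of d] by linarith
  show ?thesis
  proof (rule acc_ge_step_aux[OF s m, of F'])
    fix P x assume P: "valid P" and "proper x s"
    let ?a = "acc_prob ver w P"
    have "\<bar>emb d j\<bar> / ?n * (p j + (1 - p j) * ?a) \<le>
        \<bar>emb d j\<bar> / ?n * val sacc (F' [None, Some j] P) (f j) h fair (unit_data j)" if "j < 6" for j
    proof (cases "emb d j = 0")
      case False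
      then have "p j + (1 - p j) * ?a \<le> val sacc (F' [None, Some j] P) (f j) h fair (unit_data j)"
        using that handoverD(3)[OF F P proper_fair, of j] by (simp add: F'_def)
      then show ?thesis using pos by (intro mult_left_mono) auto
    qed simp
    then have "(\<Sum>j<6. \<bar>emb d j\<bar> / ?n * (p j + (1 - p j) * ?a)) \<le>
        (\<Sum>j<6. \<bar>emb d j\<bar> / ?n * val sacc (F' [None, Some j] P) (f j) h fair (unit_data j))"
      by (intro sum_mono) simp
    moreover have "(\<Sum>j<6. \<bar>emb d j\<bar> / ?n * (p j + (1 - p j) * ?a)) = ?p + (1 - ?p) * ?a"
    proof -
      have "(\<Sum>j<6. \<bar>emb d j\<bar> / ?n * (p j + (1 - p j) * ?a)) =
          (\<Sum>j<6. (\<bar>emb d j\<bar> * p j) / ?n * (1 - ?a) + \<bar>emb d j\<bar> / ?n * ?a)"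
        by (rule sum.cong) (auto simp: algebra_simps add_divide_distrib diff_divide_distrib)
      also have "\<dots> = ?p * (1 - ?a) + (\<Sum>j<6. \<bar>emb d j\<bar>) / ?n * ?a"
        by (simp add: sum.distrib sum_divide_distrib sum_distrib_right)
      also have "\<dots> = ?p + (1 - ?p) * ?a"
      proof -
        have "(\<Sum>j<6. \<bar>emb d j\<bar>) / ?n = 1" using pos by (simp add: l1norm_def)
        moreover have "q * (1 - ?a) + 1 * ?a = q + (1 - q) * ?a" for q by (simp add: algebra_simps)
        ultimately show ?thesis by (simp only:)
      qed
      finally show ?thesis .
    qed
    ultimately show "?p + (1 - ?p) * ?a \<le>
      (case act s (tape w h) m of
        Det R s' k \<Rightarrow> val sacc (F' [None, None] P) s' (nat (int h + k)) fair (lin R d)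
      | Coin f \<Rightarrow> (\<Sum>j<3. fair j * val sacc (F' [Some j, None] P) (f j) h (\<lambda>i. if i = j then 1 else 0) d)
      | Meas f \<Rightarrow> (\<Sum>j<6. \<bar>emb d j\<bar> / l1norm 6 (emb d) *
            val sacc (F' [None, Some j] P) (f j) h fair (unit_data j)))"
      using act by simp
  qed (use handoverD[OF F] in \<open>auto simp: F'_def\<close>)
qed

text \<open>The iterates of the contraction \<open>F\<close> agree on ever longer histories and have
  a limit \<open>P\<close> with \<open>F P = P\<close>. Its winning probability \<open>a\<close>
  satisfies \<open>p + (1 - p) * a <= a\<close>, which forces \<open>a = 1\<close> however small
  \<open>p\<close> is.\<close>

lemma acc_ge_fixed_point:
  assumes "acc_ge 1 p s0 0 (map of_rat d0)" and "0 < p"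
  shows "\<exists>P. valid P \<and> acc_prob ver w P = 1"
proof -
  obtain F where *: "handover 1 p s0 0 (map of_rat d0) F"
    using assms(1) unfolding acc_ge_def by blast
  note F = handoverD[OF *, simplified]
  obtain P0 where P0: "valid P0" using ex_valid ..
  define I where "I k = (F ^^ k) P0" for k
  have I_valid: "valid (I k)" for k by (induction k) (auto simp: I_def P0 F)
  have I_Suc: "agree k (I k) (I (Suc k))" for k
  proof (induction k)
    case (Suc k)
    then show ?case using F(2)[OF Suc] by (simp add: I_def)
  qed (simp add: agree_def)
  have I_add: "agree k (I k) (I (k + n))" for k n
  proof (induction n)
    case (Suc n)
    then show ?case using I_Suc[of "k + n"] by (auto simp: agree_def)
  qed (simp add: agree_def)
  \<comment> \<open>All iterates with index above \<open>length c\<close> agree on \<open>c\<close>,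
    so this diagonal is their limit.\<close>
  define P where "P c = I (Suc (length c)) c" for c
  have P_I: "agree k P (I k)" for k unfolding agree_def
  proof (intro allI impI)
    fix c :: "nat option list list" assume "length c < k"
    then show "P c = I k c" using I_add[of "Suc (length c)" "k - Suc (length c)"]
      by (auto simp: agree_def P_def)
  qed
  have "valid P" using I_valid by (auto simp: P_def valid_prover_def)
  have "F P c = P c" for c
    using F(2)[OF P_I[of "length c"]] by (auto simp: agree_def P_def I_def)
  then have "F P = P" by blast
  then have "p + (1 - p) * acc_prob ver w P \<le> acc_prob ver w P"
    using F(3)[OF \<open>valid P\<close> proper_fair] by (simp add: acc_prob_val)
  then have "p * 1 \<le> p * acc_prob ver w P" by (simp add: algebra_simps)
  with \<open>0 < p\<close> have "1 \<le> acc_prob ver w P" by simp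
  moreover have "acc_prob ver w P \<le> 1" by (simp add: acc_prob_val val_bounds)
  ultimately show ?thesis using \<open>valid P\<close> by force
qed

end

section \<open>Reading knapsack-game instances\<close>

text \<open>\<open>NZ\<close> is reached by a leading zero and admits no further digit, as
  \<open>is_bin\<close> demands.\<close>

datatype numst = N0 | NZ | N1

text \<open>In \<open>PLP v b\<close>, \<open>PFst v b n\<close> and \<open>PSnd v b n\<close> the flag \<open>v\<close> tells whether the pair is universal, and
  \<open>b\<close> whether its first component is the selected one.\<close>
datatype pst = PS numst | PDn | PEx | PLP bool bool | PFst bool bool numst | PSnd bool bool numst | PBad

fun num_next :: "numst \<Rightarrow> kg_sym \<Rightarrow> numst option" where
  "num_next N0 K0 = Some NZ"
| "num_next N0 K1 = Some N1"
| "num_next N1 K0 = Some N1"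
| "num_next N1 K1 = Some N1"
| "num_next _ _ = None"

text \<open>A bit \<open>u\<close> accompanies every symbol but counts only at a quantifier, where
  it is frozen into the state.\<close>

primrec pnext :: "bool \<Rightarrow> pst \<Rightarrow> kg_sym \<Rightarrow> pst" where
  "pnext u (PS n) s = (case num_next n s of Some n' \<Rightarrow> PS n'
     | None \<Rightarrow> if s = KAll \<and> n \<noteq> N0 then PLP True u else PBad)"
| "pnext u PDn s = (if s = KAll then PLP True u else PBad)"
| "pnext u PEx s = (if s = KEx then PLP False u else PBad)"
| "pnext u (PLP v b) s = (if s = KLP then PFst v b N0 else PBad)"
| "pnext u (PFst v b n) s = (case num_next n s of Some n' \<Rightarrow> PFst v b n'
     | None \<Rightarrow> if s = KComma \<and> n \<noteq> N0 then PSnd v b N0 else PBad)"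
| "pnext u (PSnd v b n) s = (case num_next n s of Some n' \<Rightarrow> PSnd v b n'
     | None \<Rightarrow> if s = KRP \<and> n \<noteq> N0 then (if v then PEx else PDn) else PBad)"
| "pnext u PBad s = PBad"

definition dig :: "kg_sym \<Rightarrow> int" where "dig s = (if s = K1 then 1 else 0)"

text \<open>Coefficients \<open>(a, b, c, e, f)\<close> of the update \<open>T := a T + b C + c\<close>, \<open>C := e C + f\<close>, where \<open>T\<close>
  is the target minus the selected numbers and \<open>C\<close> the number being read. The first pass \<open>p = True\<close>
  reads the target and subtracts the universal choices, the second one subtracts the existential ones.\<close>
definition pcoef :: "bool \<Rightarrow> pst \<Rightarrow> kg_sym \<Rightarrow> int \<times> int \<times> int \<times> int \<times> int" where
  "pcoef p ps s = (case ps of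
     PS n \<Rightarrow> if p \<and> s \<in> {K0, K1} then (2, 0, dig s, 1, 0) else (1, 0, 0, 1, 0)
   | PFst v b n \<Rightarrow> if s = KComma then (1, -1, 0, 0, 0)
       else if s \<in> {K0, K1} \<and> v = p \<and> b then (1, 0, 0, 2, dig s) else (1, 0, 0, 1, 0)
   | PSnd v b n \<Rightarrow> if s = KRP then (1, -1, 0, 0, 0)
       else if s \<in> {K0, K1} \<and> v = p \<and> \<not> b then (1, 0, 0, 2, dig s) else (1, 0, 0, 1, 0)
   | _ \<Rightarrow> (1, 0, 0, 1, 0))"

fun psym :: "bool \<Rightarrow> kg_sym \<times> bool \<Rightarrow> pst \<times> int \<times> int \<Rightarrow> pst \<times> int \<times> int" where
  "psym p (s, u) (ps, T, C) =
     (case pcoef p ps s of (a, b, c, e, f) \<Rightarrow> (pnext u ps s, a * T + b * C + c, e * C + f))"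

fun pstep :: "bool \<Rightarrow> kg_sym option \<times> bool \<Rightarrow> pst \<times> int \<times> int \<Rightarrow> pst \<times> int \<times> int" where
  "pstep p (None, u) x = x"
| "pstep p (Some s, u) x = psym p (s, u) x"

text \<open>The states after a complete target or block, where an instance may end.\<close>

definition okps :: "pst \<Rightarrow> bool" where
  "okps ps \<longleftrightarrow> ps = PDn \<or> ps = PS NZ \<or> ps = PS N1"

primrec nrun :: "numst \<Rightarrow> kg_sym list \<Rightarrow> numst option" where
  "nrun n [] = Some n"
| "nrun n (s # a) = (case num_next n s of None \<Rightarrow> None | Some n' \<Rightarrow> nrun n' a)"

lemma nrun_append: "nrun n (a @ [s]) = (case nrun n a of None \<Rightarrow> None | Some n' \<Rightarrow> num_next n' s)"
  by (induction a arbitrary: n) (auto split: option.split)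

lemma num_next_Some: "num_next n s = Some n' \<Longrightarrow> s \<in> {K0, K1} \<and> n' \<noteq> N0"
  by (cases "(n, s)" rule: num_next.cases) auto

lemma nrun_N1: "nrun N1 a = (if set a \<subseteq> {K0, K1} then Some N1 else None)"
proof (induction a)
  case (Cons s a)
  then show ?case by (cases s) auto
qed simp

lemma nrun_NZ: "nrun NZ a = (if a = [] then Some NZ else None)"
  by (cases a) auto

lemma nrun_N0_iff: "(\<exists>n. n \<noteq> N0 \<and> nrun N0 a = Some n) \<longleftrightarrow> is_bin a"
proof (cases a)
  case (Cons s a')
  then show ?thesis by (cases s) (auto simp: is_bin_def nrun_N1 nrun_NZ)
qed (auto simp: is_bin_def)

definition horner :: "int \<Rightarrow> kg_sym list \<Rightarrow> int" where
  "horner C a = foldl (\<lambda>acc s. 2 * acc + dig s) C a"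

lemma horner_simps [simp]: "horner C [] = C" "horner C (s # a) = horner (2 * C + dig s) a"
  by (simp_all add: horner_def)

lemma horner_bin_val: "horner 0 a = int (bin_val a)"
proof -
  have "horner (int n) a = int (foldl (\<lambda>acc d. 2 * acc + (if d = K1 then 1 else 0)) n a)" for n
  proof (induction a arbitrary: n)
    case (Cons s a)
    then show ?case using Cons[of "2 * n + (if s = K1 then 1 else 0)"]
      by (cases "s = K1") (auto simp: dig_def algebra_simps)
  qed simp
  from this[of 0] show ?thesis by (simp add: bin_val_def)
qed

lemma psym_digits:
  assumes "nrun n (map fst xs) = Some n'"
  shows "fold (psym p) xs (PS n, T, C) = (PS n', if p then horner T (map fst xs) else T, C)"
    and "fold (psym p) xs (PFst v b n, T, C) = (PFst v b n', T, if v = p \<and> b then horner C (map fst xs) else C)"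
    and "fold (psym p) xs (PSnd v b n, T, C) = (PSnd v b n', T, if v = p \<and> \<not> b then horner C (map fst xs) else C)"
  using assms
proof (induction xs arbitrary: n T C)
  case (Cons x xs)
  obtain s u where x: "x = (s, u)" by fastforce
  { case 1
    then obtain n1 where n1: "num_next n s = Some n1" "nrun n1 (map fst xs) = Some n'"
      by (auto simp: x split: option.splits)
    with Cons.IH(1)[OF n1(2)] num_next_Some[OF n1(1)] show ?case by (auto simp: x pcoef_def)
  next
    case 2
    then obtain n1 where n1: "num_next n s = Some n1" "nrun n1 (map fst xs) = Some n'"
      by (auto simp: x split: option.splits)
    with Cons.IH(2)[OF n1(2)] num_next_Some[OF n1(1)] show ?case by (auto simp: x pcoef_def)
  next
    case 3
    then obtain n1 where n1: "num_next n s = Some n1" "nrun n1 (map fst xs) = Some n'"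
      by (auto simp: x split: option.splits)
    with Cons.IH(3)[OF n1(2)] num_next_Some[OF n1(1)] show ?case by (auto simp: x pcoef_def)
  }
qed auto

text \<open>The comma and the closing parenthesis both subtract and clear \<open>C\<close>. A
  component that is not selected leaves \<open>C = 0\<close>, so its subtraction has no
  effect.\<close>

lemma psym_pair:
  assumes xs: "map fst xs = [KLP] @ a @ [KComma] @ b @ [KRP]" and a: "is_bin a" and b: "is_bin b"
  shows "fold (psym p) xs (PLP v u, T, 0) =
    (if v then PEx else PDn, T - (if v = p then if u then int (bin_val a) else int (bin_val b) else 0), 0)"
proof -
  obtain u1 xa u2 xb u3 where split: "xs = (KLP, u1) # xa @ (KComma, u2) # xb @ [(KRP, u3)]"
    "map fst xa = a" "map fst xb = b"
    using xs by (auto simp: map_eq_append_conv map_eq_Cons_conv append_eq_map_conv)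
  obtain n where n: "n \<noteq> N0" "nrun N0 a = Some n" using a nrun_N0_iff by blast
  obtain m where m: "m \<noteq> N0" "nrun N0 b = Some m" using b nrun_N0_iff by blast
  have [simp]: "num_next k KComma = None" "num_next k KRP = None" for k by (cases k; simp)+
  show ?thesis
    using n m psym_digits[of N0 xa n p] psym_digits[of N0 xb m p]
    by (auto simp: split pcoef_def horner_bin_val)
qed

fun opts :: "bool \<Rightarrow> kg_sym list \<times> kg_sym list \<times> kg_sym list \<times> kg_sym list \<Rightarrow> nat set" where
  "opts p (a, b, e, f) = (if p then {bin_val a, bin_val b} else {bin_val e, bin_val f})"

fun wf_blk :: "kg_sym list \<times> kg_sym list \<times> kg_sym list \<times> kg_sym list \<Rightarrow> bool" where
  "wf_blk (a, b, e, f) \<longleftrightarrow> is_bin a \<and> is_bin b \<and> is_bin e \<and> is_bin f"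

lemma psym_okps: "okps ps \<Longrightarrow> psym p (KAll, u) (ps, T, C) = (PLP True u, T, C)"
  by (auto simp: okps_def pcoef_def)

lemma psym_PEx: "psym p (KEx, u) (PEx, T, C) = (PLP False u, T, C)"
  by (simp add: pcoef_def)

lemma psym_block:
  assumes xs: "map fst xs = kg_block blk" and wf: "wf_blk blk" and ps: "okps ps"
  shows "\<exists>z\<in>opts p blk. fold (psym p) xs (ps, T, 0) = (PDn, T - int z, 0)"
proof -
  obtain a b e f where blk: "blk = (a, b, e, f)" by (cases blk)
  obtain u xa u' xe where split: "xs = (KAll, u) # xa @ (KEx, u') # xe"
    and xa: "map fst xa = [KLP] @ a @ [KComma] @ b @ [KRP]" and xe: "map fst xe = [KLP] @ e @ [KComma] @ f @ [KRP]"
  proof -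
    have split: "\<exists>u xa u' xe. xs = (KAll, u) # xa @ (KEx, u') # xe \<and> map fst xa = A \<and> map fst xe = E"
      if "map fst xs = KAll # A @ KEx # E" for A E
      using that by (auto simp: map_eq_append_conv map_eq_Cons_conv) blast
    have "map fst xs = KAll # ([KLP] @ a @ [KComma] @ b @ [KRP]) @ KEx # ([KLP] @ e @ [KComma] @ f @ [KRP])"
      using xs by (simp add: blk kg_block_def)
    from split[OF this] show thesis using that by blast
  qed
  have wf': "is_bin a" "is_bin b" "is_bin e" "is_bin f" using wf by (auto simp: blk)
  show ?thesis
    by (cases p; cases u; cases u')
       (simp_all add: split blk psym_okps[OF ps] psym_PEx psym_pair[OF xa wf'(1,2)] psym_pair[OF xe wf'(3,4)] del: psym.simps)
qed

text \<open>A constant bit throughout the block suffices, since the pass uses just the bit at its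
  own quantifier.\<close>

lemma psym_block_ex:
  assumes z: "z \<in> opts p blk" and wf: "wf_blk blk"
  shows "\<exists>xs. map fst xs = kg_block blk \<and>
    (\<forall>ps T. okps ps \<longrightarrow> fold (psym p) xs (ps, T, 0) = (PDn, T - int z, 0))"
proof -
  obtain a b e f where blk: "blk = (a, b, e, f)" by (cases blk)
  have wf': "is_bin a" "is_bin b" "is_bin e" "is_bin f" using wf by (auto simp: blk)
  define u where "u \<longleftrightarrow> z = (if p then bin_val a else bin_val e)"
  define mk where "mk s = map (\<lambda>s. (s, u)) s" for s :: "kg_sym list"
  have eq: "mk (kg_block blk) = (KAll, u) # mk ([KLP] @ a @ [KComma] @ b @ [KRP]) @ (KEx, u) # mk ([KLP] @ e @ [KComma] @ f @ [KRP])"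
    by (simp add: mk_def blk kg_block_def)
  have m: "map fst (mk s) = s" for s by (simp add: mk_def comp_def)
  have "fold (psym p) (mk (kg_block blk)) (ps, T, 0) = (PDn, T - int z, 0)" if "okps ps" for ps T
    using z unfolding eq
    by (cases p; cases u)
       (auto simp: blk psym_okps[OF that] psym_PEx psym_pair[OF m wf'(1,2)] psym_pair[OF m wf'(3,4)] u_def
         simp del: psym.simps append.simps split: if_splits)
  then show ?thesis using m by blast
qed

lemma psym_blocks:
  assumes "map fst xs = concat (map kg_block blks)" and "\<forall>blk\<in>set blks. wf_blk blk" and "okps ps"
  shows "\<exists>zs ps'. list_all2 (\<lambda>z blk. z \<in> opts p blk) zs blks \<and> okps ps' \<and>
    fold (psym p) xs (ps, T, 0) = (ps', T - int (sum_list zs), 0)"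
  using assms
proof (induction blks arbitrary: xs ps T)
  case Nil
  then show ?case by simp
next
  case (Cons blk blks)
  then obtain y1 y2 where y: "xs = y1 @ y2" "map fst y1 = kg_block blk" "map fst y2 = concat (map kg_block blks)"
    by (auto simp: map_eq_append_conv)
  obtain z where z: "z \<in> opts p blk" "fold (psym p) y1 (ps, T, 0) = (PDn, T - int z, 0)"
    using psym_block[OF y(2), of ps p T] Cons.prems by auto
  obtain zs ps' where zs: "list_all2 (\<lambda>z blk. z \<in> opts p blk) zs blks" "okps ps'"
    "fold (psym p) y2 (PDn, T - int z, 0) = (ps', (T - int z) - int (sum_list zs), 0)"
    using Cons.IH[OF y(3), of PDn "T - int z"] Cons.prems by (auto simp: okps_def)
  show ?case using z zs y by (intro exI[of _ "z # zs"] exI[of _ ps']) simp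
qed

lemma psym_blocks_ex:
  assumes "list_all2 (\<lambda>z blk. z \<in> opts p blk) zs blks" and "\<forall>blk\<in>set blks. wf_blk blk"
  shows "\<exists>xs. map fst xs = concat (map kg_block blks) \<and> (\<forall>ps T. okps ps \<longrightarrow>
    (\<exists>ps'. okps ps' \<and> fold (psym p) xs (ps, T, 0) = (ps', T - int (sum_list zs), 0)))"
  using assms
proof (induction rule: list_all2_induct)
  case Nil
  show ?case by simp
next
  case (Cons z zs blk blks)
  obtain y1 where y1: "map fst y1 = kg_block blk"
    "\<And>ps T. okps ps \<Longrightarrow> fold (psym p) y1 (ps, T, 0) = (PDn, T - int z, 0)"
    using psym_block_ex[OF Cons(1)] Cons.prems by auto
  obtain y2 where y2: "map fst y2 = concat (map kg_block blks)"
    "\<And>ps T. okps ps \<Longrightarrow> \<exists>ps'. okps ps' \<and> fold (psym p) y2 (ps, T, 0) = (ps', T - int (sum_list zs), 0)"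
    using Cons by auto
  have "\<exists>ps'. okps ps' \<and> fold (psym p) (y1 @ y2) (ps, T, 0) = (ps', T - int (sum_list (z # zs)), 0)"
    if "okps ps" for ps T
    using y1(2)[OF that, of T] y2(2)[of PDn "T - int z"] by (auto simp: okps_def algebra_simps)
  then show ?case using y1(1) y2(1) by (intro exI[of _ "y1 @ y2"]) auto
qed

definition parse :: "kg_sym list \<Rightarrow> kg_sym list \<Rightarrow> (kg_sym list \<times> kg_sym list \<times> kg_sym list \<times> kg_sym list) list \<Rightarrow> bool" where
  "parse u S blks \<longleftrightarrow> u = S @ concat (map kg_block blks) \<and> is_bin S \<and> (\<forall>blk\<in>set blks. wf_blk blk)"

lemma psym_parse:
  assumes "parse (map fst xs) S blks"
  shows "\<exists>zs ps. list_all2 (\<lambda>z blk. z \<in> opts p blk) zs blks \<and> okps ps \<and>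
    fold (psym p) xs (PS N0, T, 0) = (ps, (if p then horner T S else T) - int (sum_list zs), 0)"
proof -
  obtain y1 y2 where y: "xs = y1 @ y2" "map fst y1 = S" "map fst y2 = concat (map kg_block blks)"
    using assms by (auto simp: parse_def map_eq_append_conv)
  obtain n where n: "n \<noteq> N0" "nrun N0 S = Some n" using assms nrun_N0_iff by (auto simp: parse_def)
  have "okps (PS n)" using n by (cases n) (auto simp: okps_def)
  then show ?thesis
    using psym_blocks[OF y(3), of "PS n" p "if p then horner T S else T"] psym_digits(1)[of N0 y1 n p T 0] n y assms
    by (auto simp: parse_def)
qed

lemma psym_parse_ex:
  assumes "parse u S blks" and "list_all2 (\<lambda>z blk. z \<in> opts p blk) zs blks"
  shows "\<exists>xs. map fst xs = u \<and> (\<forall>T. \<exists>ps. okps ps \<and>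
    fold (psym p) xs (PS N0, T, 0) = (ps, (if p then horner T S else T) - int (sum_list zs), 0))"
proof -
  obtain y2 where y2: "map fst y2 = concat (map kg_block blks)"
    "\<And>ps T. okps ps \<Longrightarrow> \<exists>ps'. okps ps' \<and> fold (psym p) y2 (ps, T, 0) = (ps', T - int (sum_list zs), 0)"
    using psym_blocks_ex[OF assms(2)] assms(1) by (auto simp: parse_def)
  obtain n where n: "n \<noteq> N0" "nrun N0 S = Some n" using assms nrun_N0_iff by (auto simp: parse_def)
  have "okps (PS n)" using n by (cases n) (auto simp: okps_def)
  define y1 where "y1 = map (\<lambda>s. (s, True)) S"
  have "map fst y1 = S" by (simp add: y1_def comp_def)
  then show ?thesis
    using y2(2)[OF \<open>okps (PS n)\<close>] psym_digits(1)[of N0 y1 n p _ 0] n y2(1) assms(1)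
    by (intro exI[of _ "y1 @ y2"]) (auto simp: parse_def)
qed

section \<open>Only well-formed instances end in an admissible state\<close>

definition parsable :: "kg_sym list \<Rightarrow> bool" where
  "parsable u \<longleftrightarrow> (\<exists>S blks. parse u S blks)"

definition half :: "kg_sym list \<Rightarrow> kg_sym list \<Rightarrow> bool" where
  "half u x \<longleftrightarrow> (\<exists>y a b. parsable y \<and> is_bin a \<and> is_bin b \<and>
     u = y @ [KAll, KLP] @ a @ [KComma] @ b @ [KRP] @ x)"

text \<open>A prover must not win on a malformed output, so the shape of what was read has to be
  recovered from the state alone.\<close>

primrec pinv :: "pst \<Rightarrow> kg_sym list \<Rightarrow> bool" where
  "pinv (PS n) u \<longleftrightarrow> nrun N0 u = Some n"
| "pinv PDn u \<longleftrightarrow> parsable u"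
| "pinv PEx u \<longleftrightarrow> half u []"
| "pinv (PLP v b) u \<longleftrightarrow> (if v then \<exists>y. parsable y \<and> u = y @ [KAll] else half u [KEx])"
| "pinv (PFst v b n) u \<longleftrightarrow> (\<exists>a. nrun N0 a = Some n \<and>
     (if v then \<exists>y. parsable y \<and> u = y @ [KAll, KLP] @ a else half u ([KEx, KLP] @ a)))"
| "pinv (PSnd v b n) u \<longleftrightarrow> (\<exists>a c. is_bin a \<and> nrun N0 c = Some n \<and>
     (if v then \<exists>y. parsable y \<and> u = y @ [KAll, KLP] @ a @ [KComma] @ c
      else half u ([KEx, KLP] @ a @ [KComma] @ c)))"
| "pinv PBad u \<longleftrightarrow> True"

lemma half_append: "half u x \<Longrightarrow> half (u @ y) (x @ y)"
  unfolding half_def by auto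

lemma parsable_block:
  assumes "half u ([KEx, KLP] @ e @ [KComma] @ f @ [KRP])" "is_bin e" "is_bin f"
  shows "parsable u"
proof -
  obtain y a b where y: "parsable y" "is_bin a" "is_bin b"
    and u: "u = y @ [KAll, KLP] @ a @ [KComma] @ b @ [KRP] @ [KEx, KLP] @ e @ [KComma] @ f @ [KRP]"
    using assms(1) unfolding half_def by blast
  obtain S blks where "parse y S blks" using y(1) unfolding parsable_def by blast
  then have "parse u S (blks @ [(a, b, e, f)])"
    using y assms by (auto simp: parse_def u kg_block_def)
  then show ?thesis unfolding parsable_def by blast
qed

lemma parsable_bin: "is_bin u \<Longrightarrow> parsable u"
  unfolding parsable_def parse_def by (intro exI[of _ u] exI[of _ "[]"]) simp

lemma pinv_step:
  assumes "pinv ps u"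
  shows "pinv (pnext b ps s) (u @ [s])"
proof (cases ps)
  case (PS n)
  show ?thesis
  proof (cases "num_next n s")
    case None
    have "is_bin u" if "n \<noteq> N0" using assms PS that nrun_N0_iff by auto
    then show ?thesis using PS None parsable_bin by auto
  qed (use assms PS in \<open>auto simp: nrun_append\<close>)
next
  case PEx
  then show ?thesis using assms half_append[of u "[]" "[KEx]"] by auto
next
  case (PLP v c)
  show ?thesis
  proof (cases "s = KLP")
    case True
    have "pinv (PFst v c N0) (u @ [KLP])"
      unfolding pinv.simps using assms PLP half_append[of u "[KEx]" "[KLP]"]
      by (intro exI[of _ "[]"] conjI) auto
    then show ?thesis using PLP True by simp
  qed (use PLP in auto)
next
  case (PFst v c n)
  then obtain a where a: "nrun N0 a = Some n"
    and u: "if v then \<exists>y. parsable y \<and> u = y @ [KAll, KLP] @ a else half u ([KEx, KLP] @ a)"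
    using assms by auto
  show ?thesis
  proof (cases "num_next n s")
    case None
    have bin: "is_bin a" if "n \<noteq> N0" using a that nrun_N0_iff by auto
    have "pinv (PSnd v c N0) (u @ [KComma])" if "n \<noteq> N0"
      unfolding pinv.simps using bin[OF that] u half_append[of u "[KEx, KLP] @ a" "[KComma]"]
      by (rule_tac exI[of _ a], rule_tac exI[of _ "[]"]) auto
    then show ?thesis using PFst None by auto
  next
    case (Some n')
    have "pinv (PFst v c n') (u @ [s])"
      unfolding pinv.simps using Some a u half_append[of u "[KEx, KLP] @ a" "[s]"]
      by (rule_tac exI[of _ "a @ [s]"]) (auto simp: nrun_append)
    then show ?thesis using PFst Some by simp
  qed
next
  case (PSnd v c n)
  then obtain a e where a: "is_bin a" "nrun N0 e = Some n"
    and u: "if v then \<exists>y. parsable y \<and> u = y @ [KAll, KLP] @ a @ [KComma] @ e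
      else half u ([KEx, KLP] @ a @ [KComma] @ e)"
    using assms by auto
  show ?thesis
  proof (cases "num_next n s")
    case None
    have e: "is_bin e" if "n \<noteq> N0" using a that nrun_N0_iff by auto
    show ?thesis
    proof (cases "s = KRP \<and> n \<noteq> N0")
      case True
      show ?thesis
      proof (cases v)
        case True
        then show ?thesis using \<open>s = KRP \<and> n \<noteq> N0\<close> e a u PSnd None by (auto simp: half_def)
      next
        case False
        then have "parsable (u @ [KRP])"
          using half_append[of u "[KEx, KLP] @ a @ [KComma] @ e" "[KRP]"] e a u \<open>s = KRP \<and> n \<noteq> N0\<close>
          by (intro parsable_block[of _ a e]) auto
        then show ?thesis using False \<open>s = KRP \<and> n \<noteq> N0\<close> PSnd None by auto
      qed
    qed (use PSnd None in auto)
  next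
    case (Some n')
    have "pinv (PSnd v c n') (u @ [s])"
      unfolding pinv.simps using Some a u half_append[of u "[KEx, KLP] @ a @ [KComma] @ e" "[s]"]
      by (rule_tac exI[of _ a], rule_tac exI[of _ "e @ [s]"]) (auto simp: nrun_append)
    then show ?thesis using PSnd Some by simp
  qed
qed (use assms in auto)

lemma pinv_fold: "pinv (fst (fold (psym p) xs (PS N0, T, C))) (map fst xs)"
proof (induction xs rule: rev_induct)
  case (snoc x xs)
  obtain s u where x: "x = (s, u)" by fastforce
  obtain ps T' C' where f: "fold (psym p) xs (PS N0, T, C) = (ps, T', C')" by (metis prod_cases3)
  then show ?case using snoc pinv_step[of ps "map fst xs" u s]
    by (simp add: x split: prod.splits)
qed simp

lemma okps_parsable:
  assumes "okps (fst (fold (psym p) xs (PS N0, T, C)))"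
  shows "parsable (map fst xs)"
  using pinv_fold[of p xs T C] assms parsable_bin nrun_N0_iff[of "map fst xs"]
  by (auto simp: okps_def)

lemma L_KG_iff:
  "u \<in> L_KG \<longleftrightarrow> (\<exists>S blks. parse u S blks \<and>
     (\<forall>xs. list_all2 (\<lambda>z blk. z \<in> opts True blk) xs blks \<longrightarrow>
      (\<exists>ys. list_all2 (\<lambda>z blk. z \<in> opts False blk) ys blks \<and> bin_val S = sum_list xs + sum_list ys)))"
proof -
  have o: "z \<in> opts True blk \<longleftrightarrow> (case blk of (a, b, e, f) \<Rightarrow> z = bin_val a \<or> z = bin_val b)"
    "z \<in> opts False blk \<longleftrightarrow> (case blk of (a, b, e, f) \<Rightarrow> z = bin_val e \<or> z = bin_val f)" for z blk
    by (cases blk, simp)+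
  have w: "wf_blk blk \<longleftrightarrow> (case blk of (a, b, e, f) \<Rightarrow> is_bin a \<and> is_bin b \<and> is_bin e \<and> is_bin f)" for blk
    by (cases blk) simp
  have sum: "sum_list xs + sum_list ys = (\<Sum>i<n. xs ! i + ys ! i)"
    if "length xs = n" "length ys = n" for n and xs ys :: "nat list"
    using that by (simp add: sum_list_sum_nth sum.distrib atLeast0LessThan)
  have la2: "list_all2 R zs blks \<longleftrightarrow> length zs = length blks \<and> (\<forall>i<length blks. R (zs ! i) (blks ! i))"
    for R and zs :: "nat list" and blks :: "(kg_sym list \<times> kg_sym list \<times> kg_sym list \<times> kg_sym list) list"
    by (auto simp: list_all2_conv_all_nth)
  show ?thesis
    unfolding L_KG_def parse_def mem_Collect_eq Let_def la2 o w conj_assoc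
    by (intro ex_cong1 conj_cong all_cong1 imp_cong refl) (auto simp: sum)
qed

section \<open>Membership as a two-pass game with one bit per machine step\<close>

primrec strip :: "(kg_sym option \<times> bool) list \<Rightarrow> (kg_sym \<times> bool) list" where
  "strip [] = []"
| "strip (x # xs) = (case fst x of None \<Rightarrow> [] | Some s \<Rightarrow> [(s, snd x)]) @ strip xs"

definition outs :: "'b option list \<Rightarrow> 'b list" where
  "outs os = concat (map (\<lambda>ob. case ob of None \<Rightarrow> [] | Some b \<Rightarrow> [b]) os)"

lemma fold_pstep: "fold (pstep p) xs x = fold (psym p) (strip xs) x"
proof (induction xs arbitrary: x)
  case (Cons y ys)
  obtain ob u where y: "y = (ob, u)" by fastforce
  show ?case using Cons by (cases ob) (simp_all add: y)
qed simp

lemma map_fst_strip: "length us = length os \<Longrightarrow> map fst (strip (zip os us)) = outs os"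
  by (induction us os rule: list_induct2) (auto simp: outs_def split: option.split)

lemma strip_ex: "map fst xs = outs os \<Longrightarrow> \<exists>us. length us = length os \<and> strip (zip os us) = xs"
proof (induction os arbitrary: xs)
  case (Cons ob os)
  show ?case
  proof (cases ob)
    case None
    then obtain us where "length us = length os" "strip (zip os us) = xs"
      using Cons.IH[of xs] Cons.prems by (auto simp: outs_def)
    then show ?thesis using None by (intro exI[of _ "False # us"]) simp
  next
    case (Some b)
    then obtain u xs' where xs: "xs = (b, u) # xs'" "map fst xs' = outs os"
      using Cons.prems by (auto simp: outs_def map_eq_Cons_conv)
    then obtain us where "length us = length os" "strip (zip os us) = xs'"
      using Cons.IH[of xs'] by auto
    then show ?thesis using Some xs by (intro exI[of _ "u # us"]) simp
  qed
qed (simp add: outs_def)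

fun win :: "pst \<times> int \<times> int \<Rightarrow> bool" where
  "win (ps, T, C) \<longleftrightarrow> okps ps \<and> T = 0"

definition win2 :: "kg_sym option list \<Rightarrow> pst \<times> int \<times> int \<Rightarrow> bool" where
  "win2 os x \<longleftrightarrow> (\<exists>ys. length ys = length os \<and> win (fold (pstep False) (zip os ys) x))"

text \<open>The second pass inherits only \<open>T\<close>, and its bits are chosen with all bits of
  the first pass known.\<close>

fun win_mid :: "kg_sym option list \<Rightarrow> pst \<times> int \<times> int \<Rightarrow> bool" where
  "win_mid os (ps, T, C) \<longleftrightarrow> okps ps \<and> win2 os (PS N0, T, 0)"

text \<open>Bits at steps without output or away from quantifier symbols are idle, so one bit per
  step gives the same game as one choice per pair.\<close>

lemma L_KG_game:
  "outs os \<in> L_KG \<longleftrightarrow>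
    (\<forall>us. length us = length os \<longrightarrow> win_mid os (fold (pstep True) (zip os us) (PS N0, 0, 0)))"
proof
  assume "outs os \<in> L_KG"
  then obtain S blks where p: "parse (outs os) S blks"
    and sel: "\<And>xs. list_all2 (\<lambda>z blk. z \<in> opts True blk) xs blks \<Longrightarrow>
      \<exists>ys. list_all2 (\<lambda>z blk. z \<in> opts False blk) ys blks \<and> bin_val S = sum_list xs + sum_list ys"
    unfolding L_KG_iff by blast
  show "\<forall>us. length us = length os \<longrightarrow> win_mid os (fold (pstep True) (zip os us) (PS N0, 0, 0))"
  proof (intro allI impI)
    fix us :: "bool list" assume us: "length us = length os"
    obtain zs ps where zs: "list_all2 (\<lambda>z blk. z \<in> opts True blk) zs blks" "okps ps"
      "fold (pstep True) (zip os us) (PS N0, 0, 0) = (ps, int (bin_val S) - int (sum_list zs), 0)"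
      using psym_parse[of "strip (zip os us)" S blks True 0] p us
      by (auto simp: map_fst_strip fold_pstep horner_bin_val)
    obtain ys where ys: "list_all2 (\<lambda>z blk. z \<in> opts False blk) ys blks" "bin_val S = sum_list zs + sum_list ys"
      using sel[OF zs(1)] by blast
    obtain xs where xs: "map fst xs = outs os" "\<And>T. \<exists>ps. okps ps \<and>
        fold (psym False) xs (PS N0, T, 0) = (ps, T - int (sum_list ys), 0)"
      using psym_parse_ex[OF p ys(1)] by auto
    obtain vs where vs: "length vs = length os" "strip (zip os vs) = xs"
      using strip_ex[OF xs(1)] by blast
    have "win (fold (pstep False) (zip os vs) (PS N0, int (bin_val S) - int (sum_list zs), 0))"
      using xs(2)[of "int (bin_val S) - int (sum_list zs)"] ys(2) by (auto simp: fold_pstep vs(2))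
    then show "win_mid os (fold (pstep True) (zip os us) (PS N0, 0, 0))"
      using zs vs(1) by (auto simp: win2_def)
  qed
next
  assume *: "\<forall>us. length us = length os \<longrightarrow> win_mid os (fold (pstep True) (zip os us) (PS N0, 0, 0))"
  \<comment> \<open>Well-formedness does not depend on the bits, so one sample run of the first pass
    yields the parse.\<close>
  obtain ps T C where "fold (pstep True) (zip os (replicate (length os) True)) (PS N0, 0, 0) = (ps, T, C)"
    by (metis prod_cases3)
  moreover have "win_mid os (fold (pstep True) (zip os (replicate (length os) True)) (PS N0, 0, 0))"
    using * by simp
  ultimately have "parsable (outs os)"
    using okps_parsable[of True "strip (zip os (replicate (length os) True))" 0 0]
    by (simp add: fold_pstep map_fst_strip)
  then obtain S blks where p: "parse (outs os) S blks" unfolding parsable_def by blast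
  have "\<exists>ys. list_all2 (\<lambda>z blk. z \<in> opts False blk) ys blks \<and> bin_val S = sum_list xs + sum_list ys"
    if xs: "list_all2 (\<lambda>z blk. z \<in> opts True blk) xs blks" for xs
  proof -
    obtain ts where ts: "map fst ts = outs os" "\<exists>ps. okps ps \<and>
        fold (psym True) ts (PS N0, 0, 0) = (ps, int (bin_val S) - int (sum_list xs), 0)"
      using psym_parse_ex[OF p xs] by (auto simp: horner_bin_val dest: spec[of _ 0])
    obtain us where us: "length us = length os" "strip (zip os us) = ts"
      using strip_ex[OF ts(1)] by blast
    have "win_mid os (fold (psym True) ts (PS N0, 0, 0))"
      using *[rule_format, OF us(1)] by (simp add: fold_pstep us(2))
    then have "win2 os (PS N0, int (bin_val S) - int (sum_list xs), 0)" using ts(2) by auto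
    then obtain vs where vs: "length vs = length os"
      "win (fold (pstep False) (zip os vs) (PS N0, int (bin_val S) - int (sum_list xs), 0))"
      unfolding win2_def by blast
    obtain ys ps where "list_all2 (\<lambda>z blk. z \<in> opts False blk) ys blks"
      "fold (pstep False) (zip os vs) (PS N0, int (bin_val S) - int (sum_list xs), 0) =
        (ps, int (bin_val S) - int (sum_list xs) - int (sum_list ys), 0)"
      using psym_parse[of "strip (zip os vs)" S blks False "int (bin_val S) - int (sum_list xs)"] p vs(1)
      by (auto simp: map_fst_strip fold_pstep)
    with vs(2) show ?thesis by (intro exI[of _ ys]) auto
  qed
  with p show "outs os \<in> L_KG" unfolding L_KG_iff by blast
qed

section \<open>The protocol\<close>

lemma lin_rows:
  "lin [[a1,a2,a3,a4,a5,a6],[b1,b2,b3,b4,b5,b6],[c1,c2,c3,c4,c5,c6],[d1,d2,d3,d4,d5,d6],[e1,e2,e3,e4,e5,e6]] [W,P,T,C,A] =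
   [of_rat a1 + of_rat a2 * W + of_rat a3 * P + of_rat a4 * T + of_rat a5 * C + of_rat a6 * A,
    of_rat b1 + of_rat b2 * W + of_rat b3 * P + of_rat b4 * T + of_rat b5 * C + of_rat b6 * A,
    of_rat c1 + of_rat c2 * W + of_rat c3 * P + of_rat c4 * T + of_rat c5 * C + of_rat c6 * A,
    of_rat d1 + of_rat d2 * W + of_rat d3 * P + of_rat d4 * T + of_rat d5 * C + of_rat d6 * A,
    of_rat e1 + of_rat e2 * W + of_rat e3 * P + of_rat e4 * T + of_rat e5 * C + of_rat e6 * A]"
  by (simp add: lin_def numeral_eq_Suc algebra_simps)

lemma emb_nth: "emb [a, b, c, d, e] 0 = 1 - (a + b + c + d + e)" "emb [a, b, c, d, e] 1 = a"
  "emb [a, b, c, d, e] 2 = b" "emb [a, b, c, d, e] 3 = c" "emb [a, b, c, d, e] 4 = d" "emb [a, b, c, d, e] 5 = e"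
  for a b c d e :: real
  by (simp_all add: emb_def numeral_eq_Suc algebra_simps)

lemma sum_6: "(\<Sum>j<6. f j) = f 0 + f 1 + f 2 + f 3 + f 4 + f (5::nat)" for f :: "nat \<Rightarrow> real"
  by (simp add: numeral_eq_Suc)

lemma digit_mod:
  fixes X B c i :: nat
  assumes "i < c" "0 < B"
  shows "X mod B ^ c div B ^ i mod B = X div B ^ i mod B"
proof -
  obtain k where k: "c = i + Suc k" using assms less_iff_Suc_add by auto
  have "X mod B ^ c div B ^ i = X div B ^ i mod B ^ Suc k"
    using assms(2) by (simp only: k power_add mod_mult2_eq) simp
  then show ?thesis by (simp add: mod_mod_cancel)
qed

datatype goal = GChk nat bool | GRst | GPass2

text \<open>The flag of \<open>Swp\<close> is 0 while the head position is unmarked, 1 if the head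
  is in the last cell spelled so far, and 2 if in an earlier one. The tape is spelled from its far
  end, so a final 1 means cell 0.\<close>

datatype st = Main bool nat pst | Cont bool nat pst nat bool bool | GoL goal
  | Swp nat bool nat | ChkEnd | Wgh | SAcc | SRej

type_synonym msg = "nat \<times> bool \<times> bool \<times> nat \<times> nat"

locale simulation =
  fixes M :: "('a, kg_sym) tm" and c :: nat and eps :: rat
  assumes wf: "wf_tm M" and c: "0 < c" and eps: "0 < eps" "eps < 1 / 2"
begin

text \<open>One more than the alphabet size: symbols fit as digits, and \<open>B >= 2\<close> even
  for a one-letter alphabet, so that \<open>B ^ h\<close> determines \<open>h\<close>.\<close>

definition B :: nat where "B = Suc (tm_nwork M)"
text \<open>A sweep visits \<open>length w + 2\<close> input positions, end-markers included, and
  takes \<open>c\<close> digits at each, which covers the space bound.\<close>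

definition big :: nat where "big = B ^ c"

text \<open>The data components are \<open>W, P, T, C, A\<close>, and the rows of an update list the coefficients of
  \<open>1, W, P, T, C, A\<close>. While a claim is being checked, \<open>T\<close> and \<open>C\<close> hold the numbers to be compared with
  \<open>W\<close> and \<open>P\<close>.\<close>
definition idR :: "rat list list" where
  "idR = [[0,1,0,0,0,0], [0,0,1,0,0,0], [0,0,0,1,0,0], [0,0,0,0,1,0], [0,0,0,0,0,1]]"
definition resetR :: "rat list list" where
  "resetR = [[0,0,0,0,0,0], [1,0,0,0,0,0], [0,0,0,0,0,0], [0,0,0,0,0,0], [eps / 4,0,0,0,0,0]]"
definition pass2R :: "rat list list" where
  "pass2R = [[0,0,0,0,0,0], [1,0,0,0,0,0], [0,0,0,1,0,0], [0,0,0,0,0,0], [0,0,0,0,0,1]]"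
definition chkR :: "rat list list" where
  "chkR = [[0,1,0,0,0,0], [0,0,1,0,0,0], [0,0,0,0,0,0], [0,0,0,0,0,0], [0,0,0,0,0,0]]"
definition digR :: "nat \<Rightarrow> nat \<Rightarrow> rat list list" where
  "digR D E = [[0,1,0,0,0,0], [0,0,1,0,0,0], [of_nat D,0,0,of_nat big,0,0], [of_nat E,0,0,0,of_nat big,0], [0,0,0,0,0,0]]"
text \<open>Each difference enters with both signs, so the slack entry stays 1, and zero differences
  surely yield basis state 0. The factor \<open>2 / eps\<close> lifts a non-zero integer difference
  far above this 1. \<open>finR\<close> uses the same device next to \<open>A\<close>.\<close>

definition prepR :: "rat list list" where
  "prepR = [[0,2 / eps,0,-2 / eps,0,0], [0,-2 / eps,0,2 / eps,0,0], [0,0,2 / eps,0,-2 / eps,0],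
     [0,0,-2 / eps,0,2 / eps,0], [0,0,0,0,0,0]]"
definition finR :: "rat list list" where
  "finR = [[0,0,0,2 / eps,0,0], [0,0,0,-2 / eps,0,0], [0,0,0,0,0,0], [0,0,0,0,0,0], [0,0,0,0,0,1]]"
definition stepR :: "nat \<Rightarrow> nat \<Rightarrow> rat \<Rightarrow> int \<times> int \<times> int \<times> int \<times> int \<Rightarrow> rat list list" where
  "stepR s s' g co = (case co of (a, b, k, e, f) \<Rightarrow>
     [[0,1,of_nat s' - of_nat s,0,0,0], [0,0,g,0,0,0], [of_int k,0,0,of_int a,of_int b,0],
      [of_int f,0,0,0,of_int e,0], [0,0,0,0,0,1/2]])"

text \<open>A left move in cell 0 leaves the head there; the claim \<open>z\<close> tells when
  \<open>P\<close> must not be divided.\<close>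

definition pfac :: "bool \<Rightarrow> int \<Rightarrow> rat" where
  "pfac z dw = (if dw = 1 then of_nat B else if dw = -1 \<and> \<not> z then 1 / of_nat B else 1)"

definition swp_next :: "'a tsym \<Rightarrow> nat \<Rightarrow> bool \<Rightarrow> nat \<Rightarrow> st" where
  "swp_next \<sigma> s z f = (if \<sigma> \<noteq> REnd then Swp s z f else if f = (if z then 1 else 2) then ChkEnd else SRej)"

definition swp_move :: "'a tsym \<Rightarrow> int" where
  "swp_move \<sigma> = (if \<sigma> = REnd then 0 else 1)"

text \<open>A message \<open>(s, z, y, D, i)\<close> claims that the work tape head scans \<open>s\<close>, that it is (\<open>z\<close>) in cell 0,
  and selects by \<open>y\<close>; while a claim is being checked it supplies the next \<open>c\<close> cells \<open>D\<close> of the work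
  tape, the head being in the \<open>i\<close>-th of them (or elsewhere, if \<open>i = c\<close>).\<close>
fun act :: "st \<Rightarrow> 'a tsym \<Rightarrow> msg \<Rightarrow> st act" where
  "act (Main p q ps) \<sigma> (s, z, y, D, i) =
     (if q \<in> tm_final M then
        if okps ps then if p then Det idR (GoL GPass2) 0 else Det finR Wgh 0 else Det idR SRej 0
      else Coin (\<lambda>j. if j = 0 then GoL (GChk s z) else Cont p q ps s z (if p then j = 1 else y)))"
| "act (Cont p q ps s z u) \<sigma> m = (case tm_delta M q \<sigma> s of (q', di, s', dw, ob) \<Rightarrow>
     Det (stepR s s' (pfac z dw) (case ob of None \<Rightarrow> (1, 0, 0, 1, 0) | Some b \<Rightarrow> pcoef p ps b))
       (Main p q' (case ob of None \<Rightarrow> ps | Some b \<Rightarrow> pnext u ps b)) di)"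
| "act (GoL g) \<sigma> m = (if \<sigma> \<noteq> LEnd then Det idR (GoL g) (-1) else
     (case g of GChk s z \<Rightarrow> Det chkR (Swp s z 0) 0
      | GRst \<Rightarrow> Det resetR (Main True (tm_start M) (PS N0)) 0
      | GPass2 \<Rightarrow> Det pass2R (Main False (tm_start M) (PS N0)) 0))"
| "act (Swp s z f) \<sigma> (_, _, _, D, i) =
     (if i < c then
        if f = 0 \<and> D div B ^ i mod B = s
        then Det (digR D (B ^ i)) (swp_next \<sigma> s z (if i = 0 then 1 else 2)) (swp_move \<sigma>)
        else Det idR SRej 0
      else Det (digR D 0) (swp_next \<sigma> s z (if f = 0 then 0 else 2)) (swp_move \<sigma>))"
| "act ChkEnd \<sigma> m = Det prepR Wgh 0"
| "act Wgh \<sigma> m = Meas (\<lambda>j. if j = 0 then GoL GRst else if j = 5 then SAcc else SRej)"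
| "act SAcc \<sigma> m = Det idR SAcc 0"
| "act SRej \<sigma> m = Det idR SRej 0"

primrec okst :: "st \<Rightarrow> bool" where
  "okst (Main p q ps) \<longleftrightarrow> q < tm_nstates M"
| "okst (Cont p q ps s z u) \<longleftrightarrow> q < tm_nstates M \<and> q \<notin> tm_final M \<and> s < tm_nwork M"
| "okst (GoL g) \<longleftrightarrow> (case g of GChk s z \<Rightarrow> s < tm_nwork M | _ \<Rightarrow> True)"
| "okst (Swp s z f) \<longleftrightarrow> s < tm_nwork M \<and> f < 3"
| "okst ChkEnd \<longleftrightarrow> True" | "okst Wgh \<longleftrightarrow> True" | "okst SAcc \<longleftrightarrow> True" | "okst SRej \<longleftrightarrow> True"

definition msgs :: "msg set" where
  "msgs = {..<tm_nwork M} \<times> UNIV \<times> UNIV \<times> {..<big} \<times> {..c}"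

lemma B_pos: "0 < B" "1 < B" "0 < big" "1 < big"
proof -
  show "0 < B" "1 < B" using wf by (auto simp: B_def wf_tm_def)
  then show "0 < big" "1 < big" using c by (auto simp: big_def simp del: One_nat_def intro: one_less_power)
qed

lemma finite_pst: "finite (UNIV :: pst set)"
proof -
  have n: "finite (UNIV :: numst set)"
  proof (rule finite_subset)
    show "(UNIV :: numst set) \<subseteq> {N0, NZ, N1}" using numst.exhaust by blast
  qed simp
  let ?A = "{PDn, PEx, PBad} \<union> range PS \<union> (\<lambda>(v, b). PLP v b) ` UNIV
    \<union> (\<lambda>(v, b, n). PFst v b n) ` UNIV \<union> (\<lambda>(v, b, n). PSnd v b n) ` UNIV"
  have "x \<in> ?A" for x by (cases x) (auto simp: image_iff)
  moreover have "finite ?A" using n by (auto simp: finite_Prod_UNIV)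
  ultimately show ?thesis by (metis (no_types, lifting) UNIV_eq_I)
qed

lemma finite_okst: "finite (Collect okst)"
proof (rule finite_subset)
  let ?n = "tm_nstates M" and ?k = "tm_nwork M"
  let ?A = "(\<lambda>(p, q, ps). Main p q ps) ` (UNIV \<times> {..<?n} \<times> UNIV)
    \<union> (\<lambda>(p, q, ps, s, z, u). Cont p q ps s z u) ` (UNIV \<times> {..<?n} \<times> UNIV \<times> {..<?k} \<times> UNIV \<times> UNIV)
    \<union> (\<lambda>(s, z). GoL (GChk s z)) ` ({..<?k} \<times> UNIV) \<union> {GoL GRst, GoL GPass2}
    \<union> (\<lambda>(s, z, f). Swp s z f) ` ({..<?k} \<times> UNIV \<times> {..<3}) \<union> {ChkEnd, Wgh, SAcc, SRej}"
  show "finite ?A" using finite_pst by auto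
  have "okst x \<Longrightarrow> x \<in> ?A" for x by (cases x) (auto simp: image_iff split: goal.splits)
  then show "Collect okst \<subseteq> ?A" by blast
qed

lemma delta_ok:
  assumes "q < tm_nstates M" "q \<notin> tm_final M" "s < tm_nwork M" "tm_delta M q \<sigma> s = (q', di, s', dw, ob)"
  shows "q' < tm_nstates M" "s' < tm_nwork M" "di \<in> {-1, 0, 1}" "dw \<in> {-1, 0, 1}"
    "\<sigma> = LEnd \<Longrightarrow> di \<noteq> -1" "\<sigma> = REnd \<Longrightarrow> di \<noteq> 1"
  using wf assms unfolding wf_tm_def by (fastforce split: prod.splits)+

text \<open>The initial data are the blank tape \<open>W = 0\<close>, the head weight
  \<open>P = B ^ 0\<close> and the acceptance weight \<open>eps / 4\<close>. With
  \<open>eta = eps / 8\<close> a claim is checked with probability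
  \<open>1 - eps / 4\<close>.\<close>

sublocale protocol "Collect okst" msgs act "Main True (tm_start M) (PS N0)" SAcc SRej
  "{s. \<exists>p q ps. s = Main p q ps}" "eps / 8" "[0, 1, 0, 0, eps / 4]"
proof
  have st: "tm_start M < tm_nstates M" "0 < tm_nwork M" using wf by (auto simp: wf_tm_def)
  show "finite (Collect okst)" by (rule finite_okst)
  show "Main True (tm_start M) (PS N0) \<in> Collect okst" using st by simp
  show "finite msgs" by (simp add: msgs_def)
  show "msgs \<noteq> {}" using st B_pos by (auto simp: msgs_def)
  show "0 < eps / 8" "2 * (eps / 8) < 1" using eps by auto
next
  fix s \<sigma> m R s' k
  assume s: "s \<in> Collect okst" and m: "m \<in> msgs" and a: "act s \<sigma> m = Det R s' k"
  have st: "tm_start M < tm_nstates M" using wf by (auto simp: wf_tm_def)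
  show "s' \<in> Collect okst \<and> k \<in> {- 1, 0, 1} \<and> (\<sigma> = LEnd \<longrightarrow> k \<noteq> - 1) \<and> (\<sigma> = REnd \<longrightarrow> k \<noteq> 1)"
  proof (cases s)
    case (Main p q ps)
    then show ?thesis using a by (cases m) (auto split: if_splits)
  next
    case (Cont p q ps x z u)
    obtain q' di s'' dw ob where d: "tm_delta M q \<sigma> x = (q', di, s'', dw, ob)" by (metis prod_cases5)
    show ?thesis using delta_ok[OF _ _ _ d] a s Cont by (auto simp: d)
  next
    case (GoL g)
    then show ?thesis using a s st by (auto split: if_splits goal.splits)
  next
    case (Swp x z f)
    then show ?thesis using a s by (cases m) (auto simp: swp_next_def swp_move_def split: if_splits)
  qed (use a in auto)
next
  fix s \<sigma> m f j
  assume s: "s \<in> Collect okst" and m: "m \<in> msgs" and a: "act s \<sigma> m = Coin f"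
  show "s \<in> {s. \<exists>p q ps. s = Main p q ps} \<and> f j \<in> Collect okst - {s. \<exists>p q ps. s = Main p q ps}"
  proof (cases s)
    case (Main p q ps)
    then show ?thesis using a s m by (cases m) (auto simp: msgs_def split: if_splits)
  next
    case (Swp x z f)
    then show ?thesis using a by (cases m) (auto split: if_splits)
  qed (use a in \<open>auto split: prod.splits if_splits goal.splits\<close>)
next
  fix s \<sigma> m f j
  assume s: "s \<in> Collect okst" and m: "m \<in> msgs" and a: "act s \<sigma> m = Meas f"
  show "f j \<in> Collect okst"
  proof (cases s)
    case (Main p q ps)
    then show ?thesis using a by (cases m) (auto split: if_splits)
  next
    case (Swp x z f)
    then show ?thesis using a by (cases m) (auto split: if_splits)
  qed (use a in \<open>auto split: prod.splits if_splits goal.splits\<close>)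
qed auto

end

context simulation
begin

abbreviation K :: real where "K \<equiv> 2 / of_rat eps"

lemma lin_simps:
  "lin idR [W, P, T, C, A] = [W, P, T, C, A]"
  "lin pass2R [W, P, T, C, A] = [0, 1, T, 0, A]"
  "lin chkR [W, P, T, C, A] = [W, P, 0, 0, 0]"
  "lin (digR D E) [W, P, T, C, A] = [W, P, real big * T + real D, real big * C + real E, 0]"
  "lin prepR [W, P, T, C, A] = [K * (W - T), - (K * (W - T)), K * (P - C), - (K * (P - C)), 0]"
  "lin finR [W, P, T, C, A] = [K * T, - (K * T), 0, - 0, A]"
  "lin (stepR s s' g (a, b, k, e, f)) [W, P, T, C, A] =
     [W + (real s' - real s) * P, of_rat g * P, of_int a * T + of_int b * C + of_int k, of_int e * C + of_int f, A / 2]"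
  by (simp_all add: idR_def pass2R_def chkR_def digR_def prepR_def finR_def stepR_def lin_rows
      of_rat_divide of_rat_minus of_rat_diff algebra_simps diff_divide_distrib)

lemma lin_reset: "lin resetR d = map of_rat [0, 1, 0, 0, eps / 4]"
  by (simp add: lin_def resetR_def numeral_eq_Suc)

end

section \<open>The machine run as arithmetic on \<open>W\<close> and \<open>P\<close>\<close>

locale simulation_input = simulation M c eps for M :: "('a, kg_sym) tm" and c eps +
  fixes w :: "'a list" and u :: "kg_sym list"
  assumes halts: "\<exists>t. (case tm_run M w t of (q, ih, wt, wh, out) \<Rightarrow> q \<in> tm_final M \<and> out = u) \<and>
     (\<forall>t'\<le>t. (case tm_run M w t' of (q, ih, wt, wh, out) \<Rightarrow> wh < c * (length w + 1)))"
begin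

definition qq :: "nat \<Rightarrow> nat" where "qq t = fst (tm_run M w t)"
definition ih :: "nat \<Rightarrow> nat" where "ih t = fst (snd (tm_run M w t))"
definition wt :: "nat \<Rightarrow> nat \<Rightarrow> nat" where "wt t = fst (snd (snd (tm_run M w t)))"
definition wh :: "nat \<Rightarrow> nat" where "wh t = fst (snd (snd (snd (tm_run M w t))))"
definition out :: "nat \<Rightarrow> kg_sym list" where "out t = snd (snd (snd (snd (tm_run M w t))))"
definition delta :: "nat \<Rightarrow> nat \<times> int \<times> nat \<times> int \<times> kg_sym option" where
  "delta t = tm_delta M (qq t) (tape w (ih t)) (wt t (wh t))"
definition obs :: "nat \<Rightarrow> kg_sym option" where "obs t = snd (snd (snd (snd (delta t))))"
definition t0 :: nat where "t0 = (LEAST t. qq t \<in> tm_final M)"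

lemma run_eq: "tm_run M w t = (qq t, ih t, wt t, wh t, out t)"
  by (simp add: qq_def ih_def wt_def wh_def out_def)

lemma run_Suc: "tm_run M w (Suc t) = tm_step M w (tm_run M w t)"
  by (simp add: tm_run_def)

lemma run_0: "qq 0 = tm_start M" "ih 0 = 0" "wt 0 = (\<lambda>_. 0)" "wh 0 = 0" "out 0 = []"
  by (simp_all add: qq_def ih_def wt_def wh_def out_def tm_run_def)

lemma run_step:
  assumes "qq t \<notin> tm_final M" "delta t = (q', di, s', dw, ob)"
  shows "qq (Suc t) = q'" "ih (Suc t) = nat (int (ih t) + di)" "wt (Suc t) = (wt t)(wh t := s')"
    "wh (Suc t) = nat (int (wh t) + dw)" "out (Suc t) = out t @ (case ob of None \<Rightarrow> [] | Some b \<Rightarrow> [b])"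
  using assms run_Suc[of t] unfolding run_eq by (auto simp: tm_step_def delta_def)

lemma run_final: "qq t \<in> tm_final M \<Longrightarrow> tm_run M w (t + k) = tm_run M w t"
proof (induction k)
  case (Suc k)
  then show ?case using run_Suc[of "t + k"] run_eq[of t] by (simp add: tm_step_def)
qed simp

lemma t0: "qq t0 \<in> tm_final M" "\<And>t. t < t0 \<Longrightarrow> qq t \<notin> tm_final M" "out t0 = u"
  "\<And>t. t \<le> t0 \<Longrightarrow> wh t < c * (length w + 1)"
proof -
  obtain t where t: "qq t \<in> tm_final M" "out t = u" "\<forall>t'\<le>t. wh t' < c * (length w + 1)"
    using halts by (auto simp: run_eq)
  show fin: "qq t0 \<in> tm_final M" unfolding t0_def by (rule LeastI) (rule t)
  show "\<And>t. t < t0 \<Longrightarrow> qq t \<notin> tm_final M" unfolding t0_def by (rule not_less_Least)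
  have le: "t0 \<le> t" unfolding t0_def by (rule Least_le) (rule t)
  then show "out t0 = u" using run_final[OF fin, of "t - t0"] t(2) by (simp add: out_def)
  show "\<And>t. t \<le> t0 \<Longrightarrow> wh t < c * (length w + 1)" using t(3) le by simp
qed

lemma run_ok: "t \<le> t0 \<Longrightarrow> qq t < tm_nstates M \<and> (\<forall>i. wt t i < tm_nwork M)"
proof (induction t)
  case 0
  then show ?case using wf by (simp add: run_0 wf_tm_def)
next
  case (Suc t)
  obtain q' di s' dw ob where d: "delta t = (q', di, s', dw, ob)" by (metis prod_cases5)
  have nf: "qq t \<notin> tm_final M" using t0(2) Suc by simp
  show ?case using Suc run_step[OF nf d] delta_ok[OF _ nf _ d[unfolded delta_def]] by auto
qed

lemma outs_obs: "t \<le> t0 \<Longrightarrow> outs (map obs [0..<t]) = out t"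
proof (induction t)
  case 0
  then show ?case by (simp add: run_0 outs_def)
next
  case (Suc t)
  obtain q' di s' dw ob where d: "delta t = (q', di, s', dw, ob)" by (metis prod_cases5)
  have nf: "qq t \<notin> tm_final M" using t0(2) Suc by simp
  show ?case using Suc run_step(5)[OF nf d] by (simp add: outs_def obs_def d)
qed

definition cells :: nat where "cells = c * (length w + 2)"
definition W :: "nat \<Rightarrow> nat" where "W t = (\<Sum>i<cells. wt t i * B ^ i)"
definition P :: "nat \<Rightarrow> nat" where "P t = B ^ wh t"

lemma wh_less: "t \<le> t0 \<Longrightarrow> wh t < cells"
  using t0(4)[of t] c by (auto simp: cells_def)

lemma digits_less: "(\<And>i. g i < B) \<Longrightarrow> (\<Sum>i<n. g i * B ^ i) < B ^ n" for g :: "nat \<Rightarrow> nat"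
proof (induction n)
  case (Suc n)
  have "Suc (g n) * B ^ n \<le> B * B ^ n" using Suc.prems[of n] by (intro mult_right_mono) auto
  with Suc show ?case by simp
qed simp

lemma digits_div:
  fixes g :: "nat \<Rightarrow> nat"
  assumes "\<And>i. g i < B" "k < n"
  shows "(\<Sum>i<n. g i * B ^ i) div B ^ k mod B = g k"
proof -
  have "(\<Sum>i<n. g i * B ^ i) = (\<Sum>i<k. g i * B ^ i) + (g k * B ^ k + (\<Sum>i\<in>{Suc k..<n}. g i * B ^ i))"
  proof -
    have "{..<n} = {..<k} \<union> {k..<n}" "{..<k} \<inter> {k..<n} = {}" using assms(2) by auto
    then show ?thesis using assms(2) by (simp add: sum.union_disjoint sum.atLeast_Suc_lessThan)
  qed
  moreover have "(\<Sum>i\<in>{Suc k..<n}. g i * B ^ i) = (\<Sum>i\<in>{Suc k..<n}. g i * B ^ (i - Suc k)) * B * B ^ k"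
    unfolding sum_distrib_right
  proof (rule sum.cong)
    fix i assume "i \<in> {Suc k..<n}"
    then have "B ^ i = B ^ (i - Suc k) * B * B ^ k"
      by (metis atLeastLessThan_iff le_add_diff_inverse2 mult.assoc power_Suc power_add)
    then show "g i * B ^ i = g i * B ^ (i - Suc k) * B * B ^ k" by (simp only: mult.assoc)
  qed simp
  ultimately have "(\<Sum>i<n. g i * B ^ i) =
      (\<Sum>i<k. g i * B ^ i) + (g k + (\<Sum>i\<in>{Suc k..<n}. g i * B ^ (i - Suc k)) * B) * B ^ k"
    by (simp add: algebra_simps)
  then have "(\<Sum>i<n. g i * B ^ i) div B ^ k = g k + (\<Sum>i\<in>{Suc k..<n}. g i * B ^ (i - Suc k)) * B"
    using digits_less[of g k, OF assms(1)] B_pos(1) by simp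
  then show ?thesis using assms(1)[of k] by simp
qed

lemma wt_less_B: "t \<le> t0 \<Longrightarrow> wt t i < B"
  using run_ok[of t] by (auto simp: B_def less_Suc_eq)

lemma W_less: "t \<le> t0 \<Longrightarrow> W t < B ^ cells"
  unfolding W_def by (rule digits_less) (rule wt_less_B)

lemma W_digit: "t \<le> t0 \<Longrightarrow> W t div P t mod B = wt t (wh t)"
  unfolding W_def P_def by (rule digits_div) (auto simp: wt_less_B wh_less)

lemma W_step:
  assumes "t < t0" "delta t = (q', di, s', dw, ob)"
  shows "real (W (Suc t)) = real (W t) + (real s' - real (wt t (wh t))) * real (P t)"
proof -
  have nf: "qq t \<notin> tm_final M" using t0(2) assms by simp
  have k: "wh t \<in> {..<cells}" using wh_less[of t] assms by simp
  show ?thesis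
    unfolding W_def P_def run_step(3)[OF nf assms(2)]
    using sum.remove[OF _ k, of "\<lambda>i. wt t i * B ^ i"]
      sum.remove[OF _ k, of "\<lambda>i. ((wt t)(wh t := s')) i * B ^ i"]
    by (simp add: algebra_simps)
qed

lemma P_step:
  assumes "t < t0" "delta t = (q', di, s', dw, ob)" "z \<longleftrightarrow> wh t = 0"
  shows "real (P (Suc t)) = of_rat (pfac z dw) * real (P t)"
proof -
  have nf: "qq t \<notin> tm_final M" using t0(2) assms by simp
  have "dw \<in> {-1, 0, 1}" using delta_ok(4)[OF _ nf _ assms(2)[unfolded delta_def]] run_ok[of t] assms(1) by simp
  moreover have "B \<noteq> 0" using B_pos by simp
  ultimately show ?thesis
    unfolding P_def run_step(4)[OF nf assms(2)] using assms(3)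
    by (cases "wh t") (auto simp: pfac_def of_rat_divide nat_add_distrib)
qed

definition dat :: "nat \<Rightarrow> pst \<times> int \<times> int \<Rightarrow> real \<Rightarrow> real list" where
  "dat t x A = [real (W t), real (P t), of_int (fst (snd x)), of_int (snd (snd x)), A]"

definition coefs :: "bool \<Rightarrow> nat \<Rightarrow> pst \<Rightarrow> int \<times> int \<times> int \<times> int \<times> int" where
  "coefs p t ps = (case obs t of None \<Rightarrow> (1, 0, 0, 1, 0) | Some b \<Rightarrow> pcoef p ps b)"

text \<open>The truth of the claim is what makes the arithmetic updates match the machine; soundness
  and completeness both rest on this.\<close>

lemma Cont_step:
  assumes "t < t0" and z: "z \<longleftrightarrow> wh t = 0"
  shows "\<exists>R di. act (Cont p (qq t) ps (wt t (wh t)) z b) (tape w (ih t)) m =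
      Det R (Main p (qq (Suc t)) (fst (pstep p (obs t, b) (ps, T, C)))) di \<and>
      ih (Suc t) = nat (int (ih t) + di) \<and>
      lin R (dat t (ps, T, C) A) = dat (Suc t) (pstep p (obs t, b) (ps, T, C)) (A / 2)"
proof -
  obtain q' di s' dw ob where d: "delta t = (q', di, s', dw, ob)" by (metis prod_cases5)
  have nf: "qq t \<notin> tm_final M" using t0(2) assms by simp
  have ob: "obs t = ob" by (simp add: obs_def d)
  obtain a1 a2 a3 a4 a5 where co: "coefs p t ps = (a1, a2, a3, a4, a5)" by (metis prod_cases5)
  have ps: "pstep p (obs t, b) (ps, T, C) =
      (case ob of None \<Rightarrow> ps | Some s \<Rightarrow> pnext b ps s, a1 * T + a2 * C + a3, a4 * C + a5)"
    using co by (cases ob) (auto simp: coefs_def ob)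
  let ?R = "stepR (wt t (wh t)) s' (pfac z dw) (coefs p t ps)"
  have "act (Cont p (qq t) ps (wt t (wh t)) z b) (tape w (ih t)) m =
      Det ?R (Main p (qq (Suc t)) (fst (pstep p (obs t, b) (ps, T, C)))) di"
    using d run_step(1)[OF nf d] unfolding ps by (simp add: delta_def coefs_def ob)
  moreover have "lin ?R (dat t (ps, T, C) A) = dat (Suc t) (pstep p (obs t, b) (ps, T, C)) (A / 2)"
    unfolding ps co dat_def
    by (simp add: lin_simps W_step[OF assms(1) d] P_step[OF assms(1) d z])
  ultimately show ?thesis using run_step(2)[OF nf d] by blast
qed

sublocale protocol_input "Collect okst" msgs act "Main True (tm_start M) (PS N0)" SAcc SRej
  "{s. \<exists>p q ps. s = Main p q ps}" "eps / 8" "[0, 1, 0, 0, eps / 4]" w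
  by unfold_locales

end

section \<open>Soundness\<close>

context simulation_input
begin

abbreviation eta :: real where "eta \<equiv> of_rat (eps / 8)"
abbreviation gam :: real where "gam \<equiv> 1 - of_rat eps / 4"

lemma eps_real: "0 < (of_rat eps :: real)" "(of_rat eps :: real) < 1 / 2"
proof -
  show "0 < (of_rat eps :: real)" using eps by simp
  have "of_rat eps < (of_rat (1 / 2) :: real)" using eps by (simp only: of_rat_less)
  then show "(of_rat eps :: real) < 1 / 2" by (simp add: of_rat_divide)
qed

lemma eta_eq: "eta = of_rat eps / 8" by (simp add: of_rat_divide)

lemma tape_Suc: "tape w (Suc h) \<noteq> LEnd" by (simp add: tape_def)
lemma tape_0: "tape w 0 = LEnd" by (simp add: tape_def)
lemma tape_REnd: "tape w h = REnd \<longleftrightarrow> length w < h" by (auto simp: tape_def)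

lemma rej_GRst: "rej_ge rej_inf (GoL GRst) h d"
proof (induction h arbitrary: d)
  case 0
  have "rej_ge rej_inf (Main True (tm_start M) (PS N0)) 0 (map of_rat [0, 1, 0, 0, eps / 4])"
    by (rule rej_ge_start) auto
  then show ?case by (intro rej_ge_step) (auto simp: tape_0 lin_reset)
next
  case (Suc h)
  then show ?case by (intro rej_ge_step) (auto simp: tape_Suc nat_diff_distrib)
qed

lemma rej_GoL:
  assumes "okst (GoL g)" "rej_ge v (GoL g) 0 [x1, x2, x3, x4, x5]"
  shows "rej_ge v (GoL g) h [x1, x2, x3, x4, x5]"
proof (induction h)
  case (Suc h)
  then show ?case using assms(1) by (intro rej_ge_step) (auto simp: tape_Suc lin_simps)
qed (rule assms)

lemma l1norm_meas: "0 \<le> A \<Longrightarrow> A \<le> 1 \<Longrightarrow> l1norm 6 (emb [x, - x, y, - y, A]) = 1 + 2 * (\<bar>x\<bar> + \<bar>y\<bar>)"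
  unfolding l1norm_def sum_6 emb_nth by simp

text \<open>With \<open>S\<close> the sum of the two absolute values, rejection has probability
  \<open>2 * S / (1 + 2 * S)\<close>, and \<open>S >= 2 / eps\<close> leaves at most
  \<open>eps / 4\<close> for failure.\<close>

lemma rej_Wgh_nonzero:
  assumes "K \<le> \<bar>x\<bar> + \<bar>y\<bar>" "0 \<le> A" "A \<le> 1" "v \<le> gam"
  shows "rej_ge v Wgh h [x, - x, y, - y, A]"
proof (rule rej_ge_Meas)
  let ?S = "\<bar>x\<bar> + \<bar>y\<bar>" and ?u = "\<lambda>j::nat. if j = 0 \<or> j = 5 then 0 else 1::real"
  have "v * (1 + 2 * ?S) \<le> gam * (1 + 2 * ?S)" using assms by (intro mult_right_mono) auto
  also have "\<dots> \<le> 2 * ?S"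
  proof -
    have "2 \<le> of_rat eps * ?S" using assms(1) eps_real(1) by (simp add: field_simps)
    moreover have e: "gam * (1 + 2 * ?S) = 2 * ?S + (1 - of_rat eps / 4 - of_rat eps * ?S / 2)"
      by (simp add: algebra_simps)
    ultimately show ?thesis unfolding e using eps_real(1) by linarith
  qed
  also have "\<dots> = (\<Sum>j<6. \<bar>emb [x, - x, y, - y, A] j\<bar> * ?u j)"
    unfolding sum_6 emb_nth by simp
  finally show "v * l1norm 6 (emb [x, - x, y, - y, A]) \<le> (\<Sum>j<6. \<bar>emb [x, - x, y, - y, A] j\<bar> * ?u j)"
    unfolding l1norm_meas[OF assms(2,3)] .
qed (auto intro: rej_ge_0 rej_ge_srej)

lemma rej_Wgh_zero:
  assumes "0 \<le> A" "A \<le> 1" "v \<le> (1 - A) * rej_inf"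
  shows "rej_ge v Wgh h [0, - 0, 0, - 0, A]"
proof (rule rej_ge_Meas)
  show "v * l1norm 6 (emb [0, - 0, 0, - 0, A])
      \<le> (\<Sum>j<6. \<bar>emb [0, - 0, 0, - 0, A] j\<bar> * (if j = 0 then rej_inf else 0))"
    unfolding l1norm_meas[OF assms(1,2)] sum_6 emb_nth using assms by simp
qed (auto intro: rej_ge_0 rej_GRst)

text \<open>\<open>Y\<close> is the number spelled so far, \<open>Z\<close> the power of
  \<open>B\<close> at the marked position, counted from the last cell spelled.\<close>

definition swp_inv :: "nat \<Rightarrow> nat \<Rightarrow> nat \<Rightarrow> nat \<Rightarrow> bool" where
  "swp_inv s f Y Z \<longleftrightarrow> (f = 0 \<and> Z = 0) \<or>
     (\<exists>j. Z = B ^ j \<and> Y div B ^ j mod B = s \<and> f = (if j = 0 then 1 else 2))"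

text \<open>Further \<open>c\<close> digits shift the mark from \<open>j\<close> to
  \<open>c + j\<close>, which is not 0 as \<open>c > 0\<close>; hence flag 2.\<close>

lemma swp_inv_none:
  assumes "swp_inv s f Y Z" "D < big"
  shows "swp_inv s (if f = 0 then 0 else 2) (big * Y + D) (big * Z)"
proof (cases "f = 0")
  case True
  then show ?thesis using assms(1) by (auto simp: swp_inv_def split: if_splits)
next
  case False
  then obtain j where j: "Z = B ^ j" "Y div B ^ j mod B = s" using assms(1) by (auto simp: swp_inv_def)
  have "(big * Y + D) div big = Y" using assms(2) B_pos by (simp add: div_mult_self3)
  then have "(big * Y + D) div B ^ (c + j) = Y div B ^ j"
    by (simp add: power_add big_def div_mult2_eq)
  then show ?thesis using False j c unfolding swp_inv_def
    by (intro disjI2 exI[of _ "c + j"]) (auto simp: power_add big_def)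
qed

lemma swp_inv_mark:
  assumes "D < big" "i < c" "D div B ^ i mod B = s"
  shows "swp_inv s (if i = 0 then 1 else 2) (big * Y + D) (B ^ i)"
proof -
  have "(big * Y + D) mod B ^ c = D" using assms(1) by (simp add: big_def)
  then have "(big * Y + D) div B ^ i mod B = s"
    using digit_mod[OF assms(2) B_pos(1), of "big * Y + D"] assms(3) by simp
  then show ?thesis unfolding swp_inv_def by blast
qed

text \<open>If both differences vanish, \<open>Z = P t\<close> puts the mark at the true head
  position and \<open>Y = W t\<close> makes the claimed digit the scanned symbol, so the claim was
  true and a restart is due. Otherwise an integer difference of at least 1 is weighed.\<close>

lemma rej_ChkEnd:
  assumes t: "t \<le> t0" and inv: "swp_inv s (if z then 1 else 2) Y Z"
    and v: "v \<le> gam" "s = wt t (wh t) \<Longrightarrow> z = (wh t = 0) \<Longrightarrow> v \<le> rej_inf"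
  shows "rej_ge v ChkEnd h [real (W t), real (P t), real Y, real Z, 0]"
proof -
  let ?x = "K * (real (W t) - real Y)" and ?y = "K * (real (P t) - real Z)"
  have "rej_ge v Wgh h [?x, - ?x, ?y, - ?y, 0]"
  proof (cases "W t = Y \<and> P t = Z")
    case True
    obtain j where j: "Z = B ^ j" "Y div B ^ j mod B = s" "z = (j = 0)"
      using inv by (auto simp: swp_inv_def split: if_splits)
    then have "j = wh t" using True B_pos(2) by (simp add: P_def)
    then have "v \<le> rej_inf" using j True W_digit[OF t] by (intro v(2)) (auto simp: P_def)
    then show ?thesis using True rej_Wgh_zero[of 0 v h] by simp
  next
    case False
    then have "1 \<le> \<bar>real (W t) - real Y\<bar> + \<bar>real (P t) - real Z\<bar>" by linarith
    then have "K * 1 \<le> K * (\<bar>real (W t) - real Y\<bar> + \<bar>real (P t) - real Z\<bar>)"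
      using eps_real(1) by (intro mult_left_mono) auto
    moreover have "\<bar>K * a\<bar> = K * \<bar>a\<bar>" for a using eps_real(1) by (simp add: abs_mult)
    ultimately have "K \<le> \<bar>?x\<bar> + \<bar>?y\<bar>" by (simp only: distrib_left mult_1_right)
    then show ?thesis using v(1) by (intro rej_Wgh_nonzero) auto
  qed
  then show ?thesis by (intro rej_ge_Det) (auto simp: lin_simps)
qed

lemma rej_Swp:
  assumes t: "t \<le> t0" and v: "v \<le> gam" "s = wt t (wh t) \<Longrightarrow> z = (wh t = 0) \<Longrightarrow> v \<le> rej_inf"
    and s: "s < tm_nwork M" and inv: "swp_inv s f Y Z" and h: "h \<le> length w + 1"
  shows "rej_ge v (Swp s z f) h [real (W t), real (P t), real Y, real Z, 0]"
  using inv h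
proof (induction "length w + 1 - h" arbitrary: h f Y Z rule: less_induct)
  case less
  have v1: "v \<le> 1" using v(1) eps_real(1) by linarith
  have nxt: "rej_ge v (swp_next (tape w h) s z f') (nat (int h + swp_move (tape w h)))
      [real (W t), real (P t), real Y', real Z', 0]" if "swp_inv s f' Y' Z'" for f' Y' Z'
  proof (cases "tape w h = REnd")
    case True
    have "rej_ge v ChkEnd h [real (W t), real (P t), real Y', real Z', 0]" if "f' = (if z then 1 else 2)"
      using \<open>swp_inv s f' Y' Z'\<close> that by (intro rej_ChkEnd[where s = s and z = z, OF t _ v]) auto
    then show ?thesis using True v1 by (auto simp: swp_next_def swp_move_def rej_ge_srej)
  next
    case False
    then have "Suc h \<le> length w + 1" using less.prems by (auto simp: tape_REnd)
    then show ?thesis using less.hyps[of "Suc h"] that False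
      by (simp add: swp_next_def swp_move_def nat_add_distrib)
  qed
  show ?case
  proof (rule rej_ge_Det)
    have "f < 3" using less.prems(1) by (auto simp: swp_inv_def split: if_splits)
    then show "Swp s z f \<in> Collect okst" using s by simp
  next
    fix m assume "m \<in> msgs"
    then obtain s' z' y D i where m: "m = (s', z', y, D, i)" and D: "D < big" by (auto simp: msgs_def)
    show "\<exists>R s' k. act (Swp s z f) (tape w h) m = Det R s' k \<and>
        rej_ge v s' (nat (int h + k)) (lin R [real (W t), real (P t), real Y, real Z, 0])"
    proof (cases "i < c")
      case True
      show ?thesis
      proof (cases "f = 0 \<and> D div B ^ i mod B = s")
        case f: True
        have "Z = 0" using f less.prems(1) by (auto simp: swp_inv_def split: if_splits)
        then show ?thesis using f True nxt[OF swp_inv_mark[OF D True, of s Y]] by (simp add: m lin_simps)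
      next
        case False
        then show ?thesis using True v1 by (auto simp: m rej_ge_srej)
      qed
    next
      case False
      then show ?thesis using nxt[OF swp_inv_none[OF less.prems(1) D]] by (simp add: m lin_simps)
    qed
  qed simp
qed

text \<open>Even a true claim may be followed by a wrong spelling of the tape, so \<open>gam\<close>
  bounds \<open>v\<close> in either case.\<close>

lemma rej_check:
  assumes "t \<le> t0" "v \<le> gam" "s = wt t (wh t) \<Longrightarrow> z = (wh t = 0) \<Longrightarrow> v \<le> rej_inf" "s < tm_nwork M"
  shows "rej_ge v (GoL (GChk s z)) h (dat t x A)"
proof -
  have "rej_ge v (Swp s z 0) 0 [real (W t), real (P t), real 0, real 0, 0]"
    by (rule rej_Swp[OF assms]) (auto simp: swp_inv_def)
  then have "rej_ge v (GoL (GChk s z)) 0 (dat t x A)"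
    using assms(4) by (intro rej_ge_Det) (auto simp: dat_def tape_0 lin_simps)
  then show ?thesis unfolding dat_def by (rule rej_GoL[rotated]) (simp add: assms)
qed

definition rej_main :: "real \<Rightarrow> bool \<Rightarrow> nat \<Rightarrow> pst \<times> int \<times> int \<Rightarrow> real \<Rightarrow> bool" where
  "rej_main v p t x A \<longleftrightarrow> rej_ge v (Main p (qq t) (fst x)) (ih t) (dat t x A)"

text \<open>The two bounds on \<open>v\<close> cover true and false claims. A false claim is
  credited with its check alone and with 0 on the continuing outcomes.\<close>

lemma rej_main_step:
  assumes t: "t < t0"
    and T: "\<And>y. rej_main vT p (Suc t) (pstep p (obs t, if p then True else y) x) (A / 2)"
    and F: "\<And>y. rej_main vF p (Suc t) (pstep p (obs t, if p then False else y) x) (A / 2)"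
    and rho: "rej_inf \<le> gam"
    and v: "v \<le> (1 - 2 * eta) * rej_inf + eta * vT + eta * vF" "v \<le> (1 - 2 * eta) * gam"
  shows "rej_main v p t x A"
  unfolding rej_main_def
proof (rule rej_ge_Coin)
  have nf: "qq t \<notin> tm_final M" using t0(2) t by simp
  have q: "qq t < tm_nstates M" using run_ok[of t] t by simp
  then show "Main p (qq t) (fst x) \<in> Collect okst" by simp
  show "Main p (qq t) (fst x) \<notin> {SAcc, SRej}" by simp
  fix m assume "m \<in> msgs"
  then obtain s z y D i where m: "m = (s, z, y, D, i)" and s: "s < tm_nwork M" by (auto simp: msgs_def)
  define f where "f j = (if j = 0 then GoL (GChk s z)
    else Cont p (qq t) (fst x) s z (if p then j = 1 else y))" for j :: nat
  have act: "act (Main p (qq t) (fst x)) (tape w (ih t)) m = Coin f"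
    using nf by (simp add: m f_def fun_eq_iff)
  have "\<exists>u. (\<forall>j<3. rej_ge (u j) (f j) (ih t) (dat t x A)) \<and> v \<le> (1 - 2 * eta) * u 0 + eta * u 1 + eta * u 2"
  proof (cases "s = wt t (wh t) \<and> z = (wh t = 0)")
    case True
    have cont: "rej_ge v' (Cont p (qq t) (fst x) s z b) (ih t) (dat t x A)"
      if "rej_main v' p (Suc t) (pstep p (obs t, b) x) (A / 2)" for v' b
    proof (rule rej_ge_Det)
      show "Cont p (qq t) (fst x) s z b \<in> Collect okst" using q nf s by simp
      fix m
      obtain ps T C where x: "x = (ps, T, C)" by (metis prod_cases3)
      obtain R di where "act (Cont p (qq t) ps s z b) (tape w (ih t)) m =
        Det R (Main p (qq (Suc t)) (fst (pstep p (obs t, b) x))) di" "ih (Suc t) = nat (int (ih t) + di)"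
        "lin R (dat t x A) = dat (Suc t) (pstep p (obs t, b) x) (A / 2)"
        using Cont_step[OF t, of z p ps b m T C A] True unfolding x by blast
      then show "\<exists>R s' k. act (Cont p (qq t) (fst x) s z b) (tape w (ih t)) m = Det R s' k \<and>
          rej_ge v' s' (nat (int (ih t) + k)) (lin R (dat t x A))"
        using that by (simp add: x rej_main_def)
    qed simp
    have "rej_ge rej_inf (GoL (GChk s z)) (ih t) (dat t x A)"
      using t s rho by (intro rej_check) auto
    then show ?thesis
      using v(1) cont[OF T[of y]] cont[OF F[of y]]
      by (intro exI[of _ "\<lambda>j. if j = 0 then rej_inf else if j = 1 then vT else vF"])
         (auto simp: f_def split: if_splits)
  next
    case False
    have "rej_ge gam (GoL (GChk s z)) (ih t) (dat t x A)"
      using t s False by (intro rej_check) auto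
    then show ?thesis
      using v(2) by (intro exI[of _ "\<lambda>j. if j = 0 then gam else 0"]) (auto simp: f_def intro: rej_ge_0)
  qed
  with act show "\<exists>f u. act (Main p (qq t) (fst x)) (tape w (ih t)) m = Coin f \<and>
      (\<forall>j<3. rej_ge (u j) (f j) (ih t) (dat t x A)) \<and> v \<le> (1 - 2 * eta) * u 0 + eta * u 1 + eta * u 2"
    by blast
qed

lemma rej_end2:
  assumes A: "0 \<le> A" "A \<le> 1" and v: "v \<le> gam" "win x \<Longrightarrow> v \<le> (1 - A) * rej_inf"
  shows "rej_main v False t0 x A"
  unfolding rej_main_def
proof (rule rej_ge_Det)
  show "Main False (qq t0) (fst x) \<in> Collect okst" using run_ok[of t0] by simp
  obtain ps T C where x: "x = (ps, T, C)" by (metis prod_cases3)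
  have v1: "v \<le> 1" using v(1) eps_real(1) by linarith
  have "rej_ge v Wgh h [K * of_int T, - (K * of_int T), 0, - 0, A]" if "okps ps" for h
  proof (cases "T = 0")
    case True
    then show ?thesis using rej_Wgh_zero[OF A, of v h] v(2) that by (simp add: x)
  next
    case False
    then have "K * 1 \<le> K * \<bar>of_int T\<bar>" using eps_real(1) by (intro mult_left_mono) auto
    then show ?thesis using v(1) A eps_real(1) by (intro rej_Wgh_nonzero) (auto simp: abs_mult)
  qed
  then show "\<exists>R s' k. act (Main False (qq t0) (fst x)) (tape w (ih t0)) m = Det R s' k \<and>
      rej_ge v s' (nat (int (ih t0) + k)) (lin R (dat t0 x A))" for m
    using v1 t0(1) by (cases m) (auto simp: x dat_def lin_simps rej_ge_srej)
qed simp

lemma rej_end1: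
  assumes v: "v \<le> 1" "okps (fst x) \<Longrightarrow> rej_main v False 0 (PS N0, fst (snd x), 0) A"
  shows "rej_main v True t0 x A"
  unfolding rej_main_def
proof (rule rej_ge_Det)
  show "Main True (qq t0) (fst x) \<in> Collect okst" using run_ok[of t0] by simp
  obtain ps T C where x: "x = (ps, T, C)" by (metis prod_cases3)
  have "rej_ge v (GoL GPass2) h (dat t0 x A)" if "okps ps" for h
  proof -
    have "W 0 = 0" "P 0 = 1" by (simp_all add: W_def P_def run_0)
    then have "rej_ge v (GoL GPass2) 0 (dat t0 x A)"
      using v(2) that by (intro rej_ge_Det) (auto simp: dat_def tape_0 lin_simps x rej_main_def run_0)
    then show ?thesis unfolding dat_def by (rule rej_GoL[rotated]) simp
  qed
  then show "\<exists>R s' k. act (Main True (qq t0) (fst x)) (tape w (ih t0)) m = Det R s' k \<and>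
      rej_ge v s' (nat (int (ih t0) + k)) (lin R (dat t0 x A))" for m
    using v(1) t0(1) by (cases m) (auto simp: x dat_def lin_simps rej_ge_srej)
qed simp

section \<open>Rejection bounds for one round\<close>

abbreviation g1 :: real where "g1 \<equiv> (1 - 2 * eta) * gam"
abbreviation all_obs :: "kg_sym option list" where "all_obs \<equiv> map obs [0..<t0]"

text \<open>Lower bounds for the rejection probability when \<open>k\<close> simulation steps of the round remain:
  \<open>low\<close> in general, \<open>high\<close> if the coins may still follow a choice of universal numbers that defeats the prover.\<close>
definition low :: "nat \<Rightarrow> real \<Rightarrow> real" where
  "low k A = rej_inf - eta ^ k * (A * rej_inf)"
definition high :: "nat \<Rightarrow> real \<Rightarrow> real" where
  "high k A = rej_inf + eta ^ k * (g1 - rej_inf - A * rej_inf)"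

text \<open>Two outcomes of weight \<open>eta\<close> and the halving of \<open>A\<close> give
  \<open>2 * eta * (A / 2) = eta * A\<close>, so the correction gains exactly one factor
  \<open>eta\<close>.\<close>

lemma low_Suc: "low (Suc k) A = (1 - 2 * eta) * rej_inf + eta * low k (A / 2) + eta * low k (A / 2)"
  by (simp add: low_def algebra_simps)

lemma high_Suc: "high (Suc k) A = (1 - 2 * eta) * rej_inf + eta * high k (A / 2) + eta * low k (A / 2)"
proof -
  have "(1 - 2 * e) * r + e * (r + X * (g - r - A / 2 * r)) + e * (r - X * (A / 2 * r))
      = r + (e * X) * (g - r - A * r)" for e r X g :: real
    by (simp add: field_simps)
  then show ?thesis unfolding high_def low_def power_Suc by (simp only:)
qed

lemma eta_bounds: "0 < eta" "eta \<le> 1" "0 \<le> 1 - 2 * eta"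
  using eps_real by (auto simp: eta_eq)

lemma g1_le: "g1 \<le> gam"
proof -
  have "(1 - 2 * eta) * gam \<le> 1 * gam"
    using eps_real eta_bounds by (intro mult_right_mono) auto
  then show ?thesis by simp
qed

lemma low_le_high: "rej_inf \<le> g1 \<Longrightarrow> low k A \<le> high k A"
proof -
  assume "rej_inf \<le> g1"
  then have "0 \<le> eta ^ k * (g1 - rej_inf)" using eta_bounds by (intro mult_nonneg_nonneg) auto
  then show ?thesis by (simp add: low_def high_def right_diff_distrib)
qed

text \<open>\<open>g1\<close> is what a false claim costs at once; as the bounds stay below it,
  lying never pays.\<close>

lemma high_le: "rej_inf \<le> g1 \<Longrightarrow> 0 \<le> A \<Longrightarrow> high k A \<le> g1"
proof -
  assume r: "rej_inf \<le> g1" and A: "0 \<le> A"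
  have "eta ^ k * (g1 - rej_inf - A * rej_inf) \<le> eta ^ k * (g1 - rej_inf)"
    using eta_bounds A rej_inf_bounds by (intro mult_left_mono) auto
  also have "\<dots> \<le> 1 * (g1 - rej_inf)"
    using eta_bounds r by (intro mult_right_mono power_le_one) auto
  finally show ?thesis by (simp add: high_def)
qed

text \<open>Otherwise \<open>rej_inf > g1\<close>, and the soundness bound holds outright.\<close>

context
  assumes rho: "rej_inf \<le> g1"
begin

lemma rho_gam: "rej_inf \<le> gam" using rho g1_le by linarith

lemma rej_pass2_low: "k \<le> t0 \<Longrightarrow> 0 \<le> A \<Longrightarrow> A \<le> 1 \<Longrightarrow> rej_main (low k A) False (t0 - k) x A"
proof (induction k arbitrary: x A)
  case 0
  have "low 0 A \<le> gam" using low_le_high[OF rho, of 0 A] high_le[OF rho 0(2), of 0] g1_le by linarith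
  then show ?case using 0 rej_end2[of A "low 0 A" x] by (simp add: low_def algebra_simps)
next
  case (Suc k)
  have t: "t0 - Suc k < t0" "Suc (t0 - Suc k) = t0 - k" using Suc.prems by auto
  have "low (Suc k) A \<le> g1"
    using low_le_high[OF rho, of "Suc k" A] high_le[OF rho Suc.prems(2), of "Suc k"] by linarith
  then show ?case
    by (intro rej_main_step[OF t(1) _ _ rho_gam, where vT = "low k (A / 2)" and vF = "low k (A / 2)"])
       (use t(2) Suc in \<open>auto simp: low_Suc\<close>)
qed

text \<open>The coins do not influence the second pass, yet only one outcome is credited with
  \<open>high\<close>: one branch of weight \<open>eta\<close> per step is enough and gives the same
  recursion as in the first pass.\<close>

lemma rej_pass2_high:
  "k \<le> t0 \<Longrightarrow> 0 \<le> A \<Longrightarrow> A \<le> 1 \<Longrightarrow> \<not> win2 (map obs [t0 - k..<t0]) x \<Longrightarrow>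
    rej_main (high k A) False (t0 - k) x A"
proof (induction k arbitrary: x A)
  case 0
  have "high 0 A \<le> gam" using high_le[OF rho 0(2), of 0] g1_le by linarith
  then show ?case using 0 rej_end2[of A "high 0 A" x] by (simp add: win2_def)
next
  case (Suc k)
  have t: "t0 - Suc k < t0" "Suc (t0 - Suc k) = t0 - k" using Suc.prems by auto
  have o: "map obs [t0 - Suc k..<t0] = obs (t0 - Suc k) # map obs [t0 - k..<t0]"
    using t by (simp add: upt_conv_Cons)
  have nw: "\<not> win2 (map obs [t0 - k..<t0]) (pstep False (obs (t0 - Suc k), y) x)" for y
  proof
    assume "win2 (map obs [t0 - k..<t0]) (pstep False (obs (t0 - Suc k), y) x)"
    then obtain ys where "length ys = length (map obs [t0 - k..<t0])"
      "win (fold (pstep False) (zip (map obs [t0 - k..<t0]) ys) (pstep False (obs (t0 - Suc k), y) x))"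
      unfolding win2_def by blast
    then have "win2 (map obs [t0 - Suc k..<t0]) x"
      unfolding win2_def o by (intro exI[of _ "y # ys"]) simp
    with Suc.prems show False by blast
  qed
  have "high (Suc k) A \<le> g1" using high_le[OF rho Suc.prems(2)] .
  then show ?case
    by (intro rej_main_step[OF t(1) _ _ rho_gam, where vT = "high k (A / 2)" and vF = "low k (A / 2)"])
       (use t(2) Suc nw rej_pass2_low in \<open>auto simp: high_Suc\<close>)
qed

lemma rej_pass1_low:
  "k \<le> t0 \<Longrightarrow> 0 \<le> A \<Longrightarrow> A \<le> 1 \<Longrightarrow> rej_main (low (k + t0) A) True (t0 - k) x A"
proof (induction k arbitrary: x A)
  case 0
  have "low t0 A \<le> 1"
    using low_le_high[OF rho, of t0 A] high_le[OF rho 0(2), of t0] g1_le eps_real by linarith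
  then show ?case using 0 rej_end1[of "low t0 A" x] rej_pass2_low[of t0 A] by simp
next
  case (Suc k)
  have t: "t0 - Suc k < t0" "Suc (t0 - Suc k) = t0 - k" using Suc.prems by auto
  have "low (Suc (k + t0)) A \<le> g1"
    using low_le_high[OF rho, of "Suc (k + t0)" A] high_le[OF rho Suc.prems(2), of "Suc (k + t0)"] by linarith
  then show ?case
    by (intro rej_main_step[OF t(1) _ _ rho_gam, where vT = "low (k + t0) (A / 2)" and vF = "low (k + t0) (A / 2)"])
       (use t(2) Suc in \<open>auto simp: low_Suc\<close>)
qed

text \<open>\<open>us\<close> are coins that defeat the prover; in each step the outcome following
  \<open>us\<close> is credited with \<open>high\<close>, the other one with
  \<open>low\<close>.\<close>

lemma rej_pass1_high:
  "length us \<le> t0 \<Longrightarrow> 0 \<le> A \<Longrightarrow> A \<le> 1 \<Longrightarrow>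
    \<not> win_mid all_obs (fold (pstep True) (zip (map obs [t0 - length us..<t0]) us) x) \<Longrightarrow>
    rej_main (high (length us + t0) A) True (t0 - length us) x A"
proof (induction us arbitrary: x A)
  case Nil
  have "high t0 A \<le> 1" using high_le[OF rho Nil(2), of t0] g1_le eps_real by linarith
  moreover obtain ps T C where x: "x = (ps, T, C)" by (metis prod_cases3)
  ultimately show ?case using Nil rej_end1[of "high t0 A" x] rej_pass2_high[of t0 A] by (simp add: x)
next
  case (Cons b us)
  let ?k = "length us"
  have t: "t0 - Suc ?k < t0" "Suc (t0 - Suc ?k) = t0 - ?k" using Cons.prems by auto
  have o: "map obs [t0 - Suc ?k..<t0] = obs (t0 - Suc ?k) # map obs [t0 - ?k..<t0]"
    using t by (simp add: upt_conv_Cons)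
  have hi: "rej_main (high (?k + t0) (A / 2)) True (t0 - ?k) (pstep True (obs (t0 - Suc ?k), b) x) (A / 2)"
    using Cons.IH[of "A / 2" "pstep True (obs (t0 - Suc ?k), b) x"] Cons.prems by (simp add: o)
  have lo: "rej_main (low (?k + t0) (A / 2)) True (t0 - ?k) y (A / 2)" for y
    using Cons.prems by (intro rej_pass1_low) auto
  have le: "high (Suc (?k + t0)) A \<le> g1" using high_le[OF rho Cons.prems(2)] .
  have "rej_main (high (Suc (?k + t0)) A) True (t0 - Suc ?k) x A"
  proof (rule rej_main_step[OF t(1) _ _ rho_gam])
    show "rej_main (if b then high (?k + t0) (A / 2) else low (?k + t0) (A / 2)) True (Suc (t0 - Suc ?k))
        (pstep True (obs (t0 - Suc ?k), if True then True else y) x) (A / 2)" for y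
      using hi lo t(2) by auto
    show "rej_main (if b then low (?k + t0) (A / 2) else high (?k + t0) (A / 2)) True (Suc (t0 - Suc ?k))
        (pstep True (obs (t0 - Suc ?k), if True then False else y) x) (A / 2)" for y
      using hi lo t(2) by auto
  qed (use le in \<open>auto simp: high_Suc\<close>)
  then show ?case by simp
qed

end

lemma dat_0: "dat 0 (PS N0, 0, 0) (of_rat eps / 4) = map of_rat [0, 1, 0, 0, eps / 4]"
  by (simp add: dat_def W_def P_def run_0 of_rat_divide)

lemma outs_all_obs: "outs all_obs = u"
  using outs_obs[of t0] t0(3) by simp

lemma sound:
  assumes "u \<notin> L_KG" and "valid R"
  shows "1 - of_rat eps \<le> rej_prob ver w R"
proof -
  let ?e = "of_rat eps :: real"
  have g1: "g1 = (1 - ?e / 4) * (1 - ?e / 4)" by (simp add: eta_eq)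
  have "1 - ?e \<le> rej_inf"
  proof (cases "rej_inf \<le> g1")
    case False
    have "1 - ?e \<le> g1" unfolding g1 using eps_real by (simp add: field_simps)
    then show ?thesis using False by linarith
  next
    case True
    obtain us where us: "length us = t0" "\<not> win_mid all_obs (fold (pstep True) (zip all_obs us) (PS N0, 0, 0))"
      using assms(1) L_KG_game[of all_obs] by (auto simp: outs_all_obs)
    have "rej_main (high (t0 + t0) (?e / 4)) True 0 (PS N0, 0, 0) (?e / 4)"
      using rej_pass1_high[OF True, of us "?e / 4" "(PS N0, 0, 0)"] us eps_real by simp
    then have "rej_ge (high (t0 + t0) (?e / 4)) (Main True (tm_start M) (PS N0)) 0 (map of_rat [0, 1, 0, 0, eps / 4])"
      unfolding rej_main_def dat_0 by (simp add: run_0)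
    \<comment> \<open>A restart leads to this same configuration, so the bound for a round becomes
      an inequality for \<open>rej_inf\<close> itself; cancelling \<open>eta ^ (t0 + t0)\<close>
      removes the running time.\<close>
    then have "high (t0 + t0) (?e / 4) \<le> rej_inf" by (rule rej_ge_start_le)
    then have "eta ^ (t0 + t0) * (g1 - rej_inf - ?e / 4 * rej_inf) \<le> eta ^ (t0 + t0) * 0"
      by (simp add: high_def)
    moreover have "0 < eta ^ (t0 + t0)" using eta_bounds by simp
    ultimately have *: "g1 \<le> (1 + ?e / 4) * rej_inf" 
      by (simp only: mult_le_cancel_left_pos) (simp add: algebra_simps)
    \<comment> \<open>Three losses of \<open>eps / 4\<close> stay below \<open>eps\<close>.\<close>
    have "(1 + ?e / 4) * (1 - ?e) \<le> g1" unfolding g1 using eps_real by (simp add: field_simps)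
    with * have "(1 + ?e / 4) * (1 - ?e) \<le> (1 + ?e / 4) * rej_inf" by (rule order_trans[rotated])
    then show ?thesis using eps_real by simp
  qed
  with rej_inf_le[OF assms(2)] show ?thesis by linarith
qed

end

section \<open>Completeness\<close>

context simulation_input
begin

lemma msg_default: "(0, False, False, 0, 0) \<in> msgs"
  using B_pos wf by (simp add: msgs_def wf_tm_def)

lemma acc_Det:
  assumes "okst s" "s \<notin> {SAcc, SRej}" "act s (tape w h) (0, False, False, 0, 0) = Det R s' k"
    and "acc_ge j p s' (nat (int h + k)) (lin R d)"
  shows "acc_ge 1 p s h d"
  by (rule acc_ge_Det[OF _ assms(2) msg_default assms(3)]) (use assms(1) acc_ge_weaken[OF assms(4)] in auto)

lemma acc_GRst: "acc_ge 0 0 (GoL GRst) h d"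
proof (induction h arbitrary: d)
  case 0
  have "acc_ge 0 0 (Main True (tm_start M) (PS N0)) 0 (map of_rat [0, 1, 0, 0, eps / 4])"
    by (rule acc_ge_start) auto
  then show ?case
    using acc_Det[of "GoL GRst" 0 resetR "Main True (tm_start M) (PS N0)" 0 0 0 d] acc_ge_weaken
    by (auto simp: tape_0 lin_reset)
next
  case (Suc h)
  then show ?case
    using acc_Det[of "GoL GRst" "Suc h" idR "GoL GRst" "-1" 0 0 d] acc_ge_weaken by (auto simp: tape_Suc)
qed

lemma acc_GoL:
  assumes "okst (GoL g)" "acc_ge 0 p (GoL g) 0 [x1, x2, x3, x4, x5]"
  shows "acc_ge 0 p (GoL g) h [x1, x2, x3, x4, x5]"
proof (induction h)
  case (Suc h)
  then show ?case
    using assms(1) acc_Det[of "GoL g" "Suc h" idR "GoL g" "-1" 0 p "[x1, x2, x3, x4, x5]"] acc_ge_weaken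
    by (auto simp: tape_Suc lin_simps)
qed (rule assms)

lemma acc_Wgh:
  assumes "0 \<le> A" "A \<le> 1"
  shows "acc_ge 0 A Wgh h [0, - 0, 0, - 0, A]"
proof -
  let ?d = "[0, - 0, 0, - 0, A]" and ?p = "\<lambda>j::nat. if j = 5 then 1 else 0::real"
  have e: "emb ?d j = 0" if "j < 6" "j \<noteq> 0" "j \<noteq> 5" for j
    using that by (auto simp: emb_def nth_Cons' numeral_eq_Suc less_Suc_eq)
  have "acc_ge 1 ((\<Sum>j<6. \<bar>emb ?d j\<bar> * ?p j) / l1norm 6 (emb ?d)) Wgh h ?d"
    by (rule acc_ge_Meas[OF _ _ msg_default]) (use e in \<open>auto intro: acc_ge_sacc acc_GRst\<close>)
  moreover have "(\<Sum>j<6. \<bar>emb ?d j\<bar> * ?p j) / l1norm 6 (emb ?d) = A"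
    unfolding l1norm_meas[OF assms] sum_6 emb_nth using assms by simp
  ultimately show ?thesis using acc_ge_weaken[of 1 A] by simp
qed

text \<open>The flag in an honest sweep when the \<open>k\<close> lowest blocks of \<open>c\<close>
  cells are still to be spelled.\<close>

definition flag :: "nat \<Rightarrow> nat \<Rightarrow> nat" where
  "flag t k = (if wh t < c * k then 0 else if wh t = c * k then 1 else 2)"

lemma P_div: "P t div big ^ k = (if wh t < c * k then 0 else B ^ (wh t - c * k))"
proof (cases "wh t < c * k")
  case True
  then have "P t < big ^ k" using B_pos by (simp add: P_def big_def power_mult[symmetric])
  then show ?thesis using True by simp
next
  case False
  then have "P t = B ^ (wh t - c * k) * big ^ k"
    by (simp add: P_def big_def power_mult[symmetric] power_add[symmetric])
  then show ?thesis using False B_pos by simp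
qed

lemma Suc_div: "big * (X div big ^ Suc k) + X div big ^ k mod big = X div big ^ k"
proof -
  have "X div big ^ Suc k = X div big ^ k div big"
    by (simp add: div_mult2_eq[symmetric] mult.commute)
  then show ?thesis by simp
qed

text \<open>Before block \<open>k\<close>, counted from the low end, the honest prover has spelled
  the quotient by \<open>big ^ Suc k\<close>. At the end all differences vanish and \<open>A\<close>
  has been cleared, so the weighting surely restarts.\<close>

lemma acc_Swp:
  assumes t: "t \<le> t0" and "k + h = length w + 1"
  shows "acc_ge 0 0 (Swp (wt t (wh t)) (wh t = 0) (flag t (Suc k))) h
    [real (W t), real (P t), real (W t div big ^ Suc k), real (P t div big ^ Suc k), 0]"
  using assms(2)
proof (induction k arbitrary: h rule: less_induct)
  case (less k)
  let ?s = "wt t (wh t)" and ?z = "wh t = 0"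
  let ?D = "W t div big ^ k mod big"
  \<comment> \<open>The place of the head within block \<open>k\<close>, or \<open>c\<close> if it
    is elsewhere.\<close>
  define i where "i = (if c * k \<le> wh t \<and> wh t < c * Suc k then wh t - c * k else c)"
  let ?E = "if i < c then B ^ i else 0"
  have s: "?s < tm_nwork M" using run_ok[OF t] by simp
  have "i \<le> c" by (auto simp: i_def)
  then have m: "(0, False, False, ?D, i) \<in> msgs" using B_pos wf by (simp add: msgs_def wf_tm_def)
  have i: "i < c \<longleftrightarrow> c * k \<le> wh t \<and> wh t < c * Suc k" by (auto simp: i_def)
  have dig: "?D div B ^ i mod B = ?s" if "i < c"
  proof -
    have wh: "wh t = c * k + i" using that unfolding i by (auto simp: i_def)
    have "?D div B ^ i mod B = W t div big ^ k div B ^ i mod B"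
      using digit_mod[OF that B_pos(1)] by (simp add: big_def)
    also have "W t div big ^ k div B ^ i = W t div P t"
      by (simp add: P_def wh big_def power_add power_mult div_mult2_eq)
    finally show ?thesis using W_digit[OF t] by simp
  qed
  have Z: "big * (P t div big ^ Suc k) + ?E = P t div big ^ k"
  proof (cases "c * Suc k \<le> wh t")
    case True
    then have "wh t - c * k = c + (wh t - c * Suc k)" by simp
    then have "B ^ (wh t - c * k) = big * B ^ (wh t - c * Suc k)" by (simp only: power_add big_def)
    then show ?thesis using True i unfolding P_div by simp
  next
    case False
    then show ?thesis using i unfolding P_div by (auto simp: i_def)
  qed
  have act: "act (Swp ?s ?z (flag t (Suc k))) (tape w h) (0, False, False, ?D, i) =
      Det (digR ?D ?E) (swp_next (tape w h) ?s ?z (flag t k)) (swp_move (tape w h))"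
    using dig i c by (auto simp: flag_def i_def)
  have data: "lin (digR ?D ?E) [real (W t), real (P t), real (W t div big ^ Suc k), real (P t div big ^ Suc k), 0] =
      [real (W t), real (P t), real (W t div big ^ k), real (P t div big ^ k), 0]"
  proof -
    have "real big * real (W t div big ^ Suc k) + real ?D = real (W t div big ^ k)"
      using Suc_div[of "W t" k] by (metis of_nat_add of_nat_mult)
    moreover have "real big * real (P t div big ^ Suc k) + real ?E = real (P t div big ^ k)"
      using Z by (metis of_nat_add of_nat_mult)
    ultimately show ?thesis unfolding lin_simps by simp
  qed
  show ?case
  proof (rule acc_ge_weaken, rule acc_ge_Det[OF _ _ m act], unfold data)
    show "Swp ?s ?z (flag t (Suc k)) \<in> Collect okst" using s by (simp add: flag_def)
    show "acc_ge 0 0 (swp_next (tape w h) ?s ?z (flag t k)) (nat (int h + swp_move (tape w h)))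
        [real (W t), real (P t), real (W t div big ^ k), real (P t div big ^ k), 0]"
    proof (cases k)
      case 0
      have "acc_ge 0 0 Wgh h [0, - 0, 0, - 0, 0]" by (rule acc_Wgh) auto
      then have "acc_ge 0 0 ChkEnd h [real (W t), real (P t), real (W t), real (P t), 0]"
        using acc_Det[of ChkEnd h prepR Wgh 0 0 0 "[real (W t), real (P t), real (W t), real (P t), 0]"] acc_ge_weaken
        by (auto simp: lin_simps)
      then show ?thesis using 0 less.prems by (auto simp: swp_next_def swp_move_def tape_REnd flag_def nat_add_distrib)
    next
      case (Suc k')
      then show ?thesis using less.IH[of k' "Suc h"] less.prems
        by (simp add: swp_next_def swp_move_def tape_REnd nat_add_distrib)
    qed
  qed simp
qed

lemma acc_check:
  assumes t: "t \<le> t0"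
  shows "acc_ge 0 0 (GoL (GChk (wt t (wh t)) (wh t = 0))) h (dat t x A)"
proof -
  have s: "wt t (wh t) < tm_nwork M" using run_ok[OF t] by simp
  \<comment> \<open>All cells lie in the \<open>length w + 2\<close> blocks of the sweep, so the
    initial quotient is 0, as is the cleared \<open>T\<close>.\<close>
  have "big ^ Suc (length w + 1) = B ^ cells" by (simp add: big_def cells_def power_mult[symmetric] power_add[symmetric] algebra_simps)
  then have "W t div big ^ Suc (length w + 1) = 0" using W_less[OF t] by simp
  moreover have "wh t < c * Suc (length w + 1)" using wh_less[OF t] by (simp add: cells_def)
  ultimately have "acc_ge 0 0 (Swp (wt t (wh t)) (wh t = 0) 0) 0 [real (W t), real (P t), 0, 0, 0]"
    using acc_Swp[OF t, of "length w + 1" 0] by (simp add: flag_def P_div del: power_Suc mult_Suc_right)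
  then have "acc_ge 0 0 (GoL (GChk (wt t (wh t)) (wh t = 0))) 0 (dat t x A)"
    using s acc_Det[of "GoL (GChk (wt t (wh t)) (wh t = 0))" 0 chkR "Swp (wt t (wh t)) (wh t = 0) 0" 0 0 0 "dat t x A"]
      acc_ge_weaken by (auto simp: dat_def tape_0 lin_simps)
  then show ?thesis unfolding dat_def by (rule acc_GoL[rotated]) (simp add: s)
qed

text \<open>Only positivity has to survive each step: the fixed point yields probability 1 from any
  \<open>r > 0\<close>.\<close>

definition acc_main :: "bool \<Rightarrow> nat \<Rightarrow> pst \<times> int \<times> int \<Rightarrow> real \<Rightarrow> bool" where
  "acc_main p t x A \<longleftrightarrow> (\<exists>r>0. acc_ge 1 r (Main p (qq t) (fst x)) (ih t) (dat t x A))"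

text \<open>The check of an honest claim contributes 0, both continuing outcomes contribute positive
  amounts.\<close>

lemma acc_main_step:
  assumes t: "t < t0"
    and nxt: "\<And>b. acc_main p (Suc t) (pstep p (obs t, if p then b else y) x) (A / 2)"
  shows "acc_main p t x A"
proof -
  have nf: "qq t \<notin> tm_final M" using t0(2) t by simp
  have q: "qq t < tm_nstates M" and s: "wt t (wh t) < tm_nwork M" using run_ok[of t] t by auto
  define f where "f j = (if j = 0 then GoL (GChk (wt t (wh t)) (wh t = 0))
    else Cont p (qq t) (fst x) (wt t (wh t)) (wh t = 0) (if p then j = 1 else y))" for j :: nat
  have m: "(wt t (wh t), wh t = 0, y, 0, 0) \<in> msgs" using s B_pos by (simp add: msgs_def)
  have act: "act (Main p (qq t) (fst x)) (tape w (ih t)) (wt t (wh t), wh t = 0, y, 0, 0) = Coin f"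
    using nf by (simp add: f_def fun_eq_iff)
  have cont: "\<exists>r>0. acc_ge 0 r (f j) (ih t) (dat t x A)" if "j \<noteq> 0" for j
  proof -
    let ?b = "if p then j = 1 else y"
    obtain ps T C where x: "x = (ps, T, C)" by (metis prod_cases3)
    obtain R di where R: "act (Cont p (qq t) ps (wt t (wh t)) (wh t = 0) ?b) (tape w (ih t)) (0, False, False, 0, 0) =
        Det R (Main p (qq (Suc t)) (fst (pstep p (obs t, ?b) x))) di" "ih (Suc t) = nat (int (ih t) + di)"
        "lin R (dat t x A) = dat (Suc t) (pstep p (obs t, ?b) x) (A / 2)"
      using Cont_step[OF t refl, of p ps ?b "(0, False, False, 0, 0)" T C A] unfolding x by blast
    obtain r where "r > 0" "acc_ge 1 r (Main p (qq (Suc t)) (fst (pstep p (obs t, ?b) x))) (ih (Suc t))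
        (dat (Suc t) (pstep p (obs t, ?b) x) (A / 2))"
      using nxt[of "j = 1"] unfolding acc_main_def by blast
    then have "acc_ge 1 r (Cont p (qq t) ps (wt t (wh t)) (wh t = 0) ?b) (ih t) (dat t x A)"
      using acc_Det[OF _ _ R(1), of 1 r "dat t x A"] by (simp add: q s nf R(2,3))
    from acc_ge_weaken[OF this] \<open>r > 0\<close> that show ?thesis unfolding f_def x by auto
  qed
  obtain r1 where r1: "r1 > 0" "acc_ge 0 r1 (f 1) (ih t) (dat t x A)" using cont[of 1] by auto
  obtain r2 where r2: "r2 > 0" "acc_ge 0 r2 (f 2) (ih t) (dat t x A)" using cont[of 2] by auto
  have f0: "acc_ge 0 0 (f 0) (ih t) (dat t x A)" using acc_check[of t] t by (simp add: f_def)
  have "acc_ge 1 ((1 - 2 * eta) * 0 + eta * r1 + eta * r2) (Main p (qq t) (fst x)) (ih t) (dat t x A)"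
    using acc_ge_Coin[OF _ _ m act, of "\<lambda>j. if j = 0 then 0 else if j = 1 then r1 else r2"] f0 r1 r2 q by simp
  moreover have "0 < (1 - 2 * eta) * 0 + eta * r1 + eta * r2" using r1 r2 eta_bounds by (simp add: add_pos_pos)
  ultimately show ?thesis unfolding acc_main_def by blast
qed

lemma acc_end2:
  assumes "0 < A" "A \<le> 1" "win x"
  shows "acc_main False t0 x A"
proof -
  obtain ps C where x: "x = (ps, 0, C)" "okps ps" using assms(3) by (cases x) auto
  have "acc_ge 0 A Wgh (ih t0) [0, - 0, 0, - 0, A]" using assms by (intro acc_Wgh) auto
  then have "acc_ge 1 A (Main False (qq t0) (fst x)) (ih t0) (dat t0 x A)"
    using run_ok[of t0] t0(1) x
    by (intro acc_Det[of _ _ finR Wgh 0 0]) (auto simp: dat_def lin_simps)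
  with assms(1) show ?thesis unfolding acc_main_def by blast
qed

lemma acc_end1:
  assumes "okps (fst x)" "acc_main False 0 (PS N0, fst (snd x), 0) A"
  shows "acc_main True t0 x A"
proof -
  have "W 0 = 0" "P 0 = 1" by (simp_all add: W_def P_def run_0)
  moreover obtain r where r: "r > 0"
    "acc_ge 1 r (Main False (qq 0) (PS N0)) (ih 0) (dat 0 (PS N0, fst (snd x), 0) A)"
    using assms(2) unfolding acc_main_def by auto
  ultimately have "acc_ge 0 r (GoL GPass2) 0 (dat t0 x A)"
    using acc_Det[of "GoL GPass2" 0 pass2R "Main False (tm_start M) (PS N0)" 0 1 r "dat t0 x A"]
    by (auto simp: dat_def tape_0 lin_simps run_0 intro: acc_ge_weaken)
  then have "acc_ge 0 r (GoL GPass2) (ih t0) (dat t0 x A)"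
    unfolding dat_def by (rule acc_GoL[rotated]) simp
  then have "acc_ge 1 r (Main True (qq t0) (fst x)) (ih t0) (dat t0 x A)"
    using run_ok[of t0] t0(1) assms(1)
    by (intro acc_Det[of _ _ idR "GoL GPass2" 0 0]) (auto simp: dat_def lin_simps)
  with r(1) show ?thesis unfolding acc_main_def by blast
qed

lemma acc_pass2:
  "k \<le> t0 \<Longrightarrow> 0 < A \<Longrightarrow> A \<le> 1 \<Longrightarrow> win2 (map obs [t0 - k..<t0]) x \<Longrightarrow> acc_main False (t0 - k) x A"
proof (induction k arbitrary: x A)
  case 0
  then show ?case by (auto simp: win2_def intro: acc_end2)
next
  case (Suc k)
  have t: "t0 - Suc k < t0" "Suc (t0 - Suc k) = t0 - k" using Suc.prems by auto
  have o: "map obs [t0 - Suc k..<t0] = obs (t0 - Suc k) # map obs [t0 - k..<t0]"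
    using t by (simp add: upt_conv_Cons)
  obtain y ys where "length ys = length (map obs [t0 - k..<t0])"
    "win (fold (pstep False) (zip (map obs [t0 - k..<t0]) ys) (pstep False (obs (t0 - Suc k), y) x))"
    using Suc.prems(4) unfolding win2_def o by (auto simp: length_Suc_conv)
  then have "win2 (map obs [t0 - k..<t0]) (pstep False (obs (t0 - Suc k), y) x)"
    unfolding win2_def by blast
  then show ?case using Suc t(2) by (intro acc_main_step[OF t(1), where y = y]) auto
qed

lemma acc_pass1:
  "k \<le> t0 \<Longrightarrow> 0 < A \<Longrightarrow> A \<le> 1 \<Longrightarrow>
    (\<And>us. length us = k \<Longrightarrow> win_mid all_obs (fold (pstep True) (zip (map obs [t0 - k..<t0]) us) x)) \<Longrightarrow>
    acc_main True (t0 - k) x A"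
proof (induction k arbitrary: x A)
  case 0
  obtain ps T C where x: "x = (ps, T, C)" by (metis prod_cases3)
  have "acc_main True t0 x A"
    using 0(4)[of "[]"] acc_pass2[of t0 A] 0(2,3) by (intro acc_end1) (auto simp: x)
  then show ?case by simp
next
  case (Suc k)
  have t: "t0 - Suc k < t0" "Suc (t0 - Suc k) = t0 - k" using Suc.prems by auto
  have o: "map obs [t0 - Suc k..<t0] = obs (t0 - Suc k) # map obs [t0 - k..<t0]"
    using t by (simp add: upt_conv_Cons)
  have "acc_main True (t0 - k) (pstep True (obs (t0 - Suc k), b) x) (A / 2)" for b
    using Suc.prems(4)[of "b # _"] Suc.prems by (intro Suc.IH) (auto simp: o)
  then show ?case using t(2) by (intro acc_main_step[OF t(1)]) auto
qed

lemma complete: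
  assumes "u \<in> L_KG"
  shows "\<exists>R. valid R \<and> acc_prob ver w R = 1"
proof -
  have "acc_main True 0 (PS N0, 0, 0) (of_rat eps / 4)"
    using acc_pass1[of t0 "of_rat eps / 4" "(PS N0, 0, 0)"] assms L_KG_game[of all_obs] eps_real
    by (auto simp: outs_all_obs)
  then obtain r where "0 < r" "acc_ge 1 r (Main True (tm_start M) (PS N0)) 0 (map of_rat [0, 1, 0, 0, eps / 4])"
    unfolding acc_main_def dat_0 by (auto simp: run_0)
  then show ?thesis by (intro acc_ge_fixed_point)
qed

end

theorem theorem8:
  fixes L :: "('a::finite) list set" and eps :: rat
  assumes "linear_space_reducible L L_KG"
    and "0 < eps" and "eps < 1/2"
  shows "\<exists>V :: 'a adfa. AM_verifies V L eps \<and> perfect_completeness V L"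
proof -
  obtain f where "linear_space_computable f" and f: "\<And>w. w \<in> L \<longleftrightarrow> f w \<in> L_KG"
    using assms(1) unfolding linear_space_reducible_def by blast
  then obtain M :: "('a, kg_sym) tm" and c where M: "wf_tm M" "tm_computes_in_space M f (\<lambda>n. c * (n + 1))"
    unfolding linear_space_computable_def by blast
  have halts: "\<exists>t. (case tm_run M w t of (q, ih, wt, wh, out) \<Rightarrow> q \<in> tm_final M \<and> out = f w) \<and>
     (\<forall>t'\<le>t. (case tm_run M w t' of (q, ih, wt, wh, out) \<Rightarrow> wh < c * (length w + 1)))" for w
    using M(2) unfolding tm_computes_in_space_def by blast
  \<comment> \<open>At time 0 the work head already lies below the space bound.\<close>
  then have "0 < c" by (fastforce intro: Nat.gr0I)
  then interpret simulation M c eps using M(1) assms by unfold_locales auto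
  have input: "simulation_input M c eps w (f w)" for w
    using halts by unfold_locales blast
  have comp: "\<exists>P. valid_prover ver P \<and> acc_prob ver w P = 1" if "w \<in> L" for w
    using simulation_input.complete[OF input] that f by blast
  moreover have "1 - of_rat eps \<le> rej_prob ver w P" if "w \<notin> L" "valid_prover ver P" for w P
    using simulation_input.sound[OF input] that f by blast
  moreover have "(1::real) - of_rat eps \<le> 1" using assms by simp
  ultimately have "AM_verifies ver L eps" "perfect_completeness ver L"
    unfolding AM_verifies_def perfect_completeness_def using wf_ver by (metis, blast)
  then show ?thesis by blast
qed

end
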